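(* For all formulas $A,B$, the following are equivalent: (1) ${\sf AR}^{\sf A}_{\sf par}\vdash A\rhd B$; (2) $A\rhd_{{\sf NNIL}({\sf par})}B$; (3) $\vdash A^\star\to B$.
   Context: Language: $\wedge,\vee,\to,\bot$ over finite atoms ${\sf atom}={\sf var}\cup{\sf par}$ (disjoint variables and parameters); $\vdash$ is ${\sf IPC}$-derivability. Substitutions commute with connectives, fix $\bot$ and fix every parameter. ${\sf NNIL}$ is the least class containing atoms, $\bot,\top$, closed under $\wedge,\vee$, and containing $B\to C$ whenever $C\in{\sf NNIL}$ and $B$ is built from atoms, $\bot,\top$ by $\wedge,\vee$ only; ${\sf NNIL}({\sf par})$: those whose atoms are all parameters. Preservativity: $A\rhd_\Gamma B$ iff for every $E\in\Gamma$, $\vdash E\to A$ implies $\vdash E\to B$. ${\sf AR}^{\sf A}_{\sf par}$ derives statements $A\rhd B$ from: Ax ($A\rhd B$ whenever $\vdash A\to B$); ${\sf V}$: $(B\to C)\rhd\bigvee_{i=1}^{n+m}B[E_i]$ with $B=\bigwedge_{i=1}^n(E_i\to F_i)$, $C=\bigvee_{i=n+1}^{n+m}E_i$, $B[E]:=E$ if $E\in{\sf par}\cup\{\bot\}$ and $B\to E$ otherwise; ${\sf sub}$: $A\rhd\theta(A)$ for every substitution $\theta$; rules Conj ($A\rhd B$, $A\rhd C$ / $A\rhd B\wedge C$), Cut ($A\rhd B$, $B\rhd C$ / $A\rhd C$), Disj ($B\rhd A$, $C\rhd A$ / $B\vee C\rhd A$), Mont$({\sf par})$ ($A\rhd B$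 / $(p\to A)\rhd(p\to B)$ for $p\in{\sf par}$). $A^\star$ denotes the formula effectively computed from $A$ that satisfies: $A^\star\in{\sf NNIL}({\sf par})$, ${\sf IPC}\vdash A^\star\to A$, ${\sf AR}^{\sf A}_{\sf par}\vdash A\rhd A^\star$, and every atom of $A^\star$ occurs in $A$. *)

theory Defs
  imports Main
begin

datatype (atoms: 'a) fm =
    Atom 'a
  | Bot
  | And "'a fm" "'a fm" (infixr "\<^bold>\<and>" 70)
  | Or "'a fm" "'a fm" (infixr "\<^bold>\<or>" 65)
  | Imp "'a fm" "'a fm" (infixr "\<^bold>\<rightarrow>" 60)

abbreviation Top :: "'a fm" where
  "Top \<equiv> Bot \<^bold>\<rightarrow> Bot"

fun Conjs :: "'a fm list \<Rightarrow> 'a fm" where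
  "Conjs [] = Top"
| "Conjs [A] = A"
| "Conjs (A # B # As) = A \<^bold>\<and> Conjs (B # As)"

fun Disjs :: "'a fm list \<Rightarrow> 'a fm" where
  "Disjs [] = Bot"
| "Disjs [A] = A"
| "Disjs (A # B # As) = A \<^bold>\<or> Disjs (B # As)"

inductive nd :: "'a fm set \<Rightarrow> 'a fm \<Rightarrow> bool" where
  Assm: "A \<in> H \<Longrightarrow> nd H A"
| BotE: "nd H Bot \<Longrightarrow> nd H A"
| AndI: "nd H A \<Longrightarrow> nd H B \<Longrightarrow> nd H (A \<^bold>\<and> B)"
| AndE1: "nd H (A \<^bold>\<and> B) \<Longrightarrow> nd H A"
| AndE2: "nd H (A \<^bold>\<and> B) \<Longrightarrow> nd H B"
| OrI1: "nd H A \<Longrightarrow> nd H (A \<^bold>\<or> B)"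
| OrI2: "nd H B \<Longrightarrow> nd H (A \<^bold>\<or> B)"
| OrE: "nd H (A \<^bold>\<or> B) \<Longrightarrow> nd (insert A H) C \<Longrightarrow> nd (insert B H) C \<Longrightarrow> nd H C"
| ImpI: "nd (insert A H) B \<Longrightarrow> nd H (A \<^bold>\<rightarrow> B)"
| ImpE: "nd H (A \<^bold>\<rightarrow> B) \<Longrightarrow> nd H A \<Longrightarrow> nd H B"

definition IPC :: "'a fm \<Rightarrow> bool" where
  "IPC A \<longleftrightarrow> nd {} A"

text \<open>
  From here on a set \<open>par\<close> of atoms is singled out as the parameters; all the
  remaining atoms are the variables. A substitution is given by its values on
  atoms, and has to fix the parameters.
\<close>

primrec subst :: "('a \<Rightarrow> 'a fm) \<Rightarrow> 'a fm \<Rightarrow> 'a fm" where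
  "subst \<theta> (Atom a) = \<theta> a"
| "subst \<theta> Bot = Bot"
| "subst \<theta> (A \<^bold>\<and> B) = subst \<theta> A \<^bold>\<and> subst \<theta> B"
| "subst \<theta> (A \<^bold>\<or> B) = subst \<theta> A \<^bold>\<or> subst \<theta> B"
| "subst \<theta> (A \<^bold>\<rightarrow> B) = subst \<theta> A \<^bold>\<rightarrow> subst \<theta> B"

definition substitution :: "'a set \<Rightarrow> ('a \<Rightarrow> 'a fm) \<Rightarrow> bool" where
  "substitution par \<theta> \<longleftrightarrow> (\<forall>p\<in>par. \<theta> p = Atom p)"

inductive_set positive :: "'a fm set" where
  "Atom a \<in> positive"
| "Bot \<in> positive"
| "Top \<in> positive"
| "A \<in> positive \<Longrightarrow> B \<in> positive \<Longrightarrow> A \<^bold>\<and> B \<in> positive"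
| "A \<in> positive \<Longrightarrow> B \<in> positive \<Longrightarrow> A \<^bold>\<or> B \<in> positive"

inductive_set NNIL :: "'a fm set" where
  "Atom a \<in> NNIL"
| "Bot \<in> NNIL"
| "Top \<in> NNIL"
| "A \<in> NNIL \<Longrightarrow> B \<in> NNIL \<Longrightarrow> A \<^bold>\<and> B \<in> NNIL"
| "A \<in> NNIL \<Longrightarrow> B \<in> NNIL \<Longrightarrow> A \<^bold>\<or> B \<in> NNIL"
| "B \<in> positive \<Longrightarrow> C \<in> NNIL \<Longrightarrow> B \<^bold>\<rightarrow> C \<in> NNIL"

definition NNIL_over :: "'a set \<Rightarrow> 'a fm set" where
  "NNIL_over par = {A \<in> NNIL. atoms A \<subseteq> par}"

definition preservativity :: "'a fm set \<Rightarrow> 'a fm \<Rightarrow> 'a fm \<Rightarrow> bool" where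
  "preservativity \<Gamma> A B \<longleftrightarrow> (\<forall>E\<in>\<Gamma>. IPC (E \<^bold>\<rightarrow> A) \<longrightarrow> IPC (E \<^bold>\<rightarrow> B))"

text \<open>Written \<open>B[E]\<close> in the literature.\<close>

definition bracket :: "'a set \<Rightarrow> 'a fm \<Rightarrow> 'a fm \<Rightarrow> 'a fm" where
  "bracket par B E = (if E \<in> Atom ` par \<union> {Bot} then E else B \<^bold>\<rightarrow> E)"

text \<open>
  In V the list \<open>EFs\<close> holds the pairs \<open>(E\<^sub>i, F\<^sub>i)\<close> with
  \<open>1 \<le> i \<le> n\<close>, and \<open>Es\<close> the formulas \<open>E\<^sub>i\<close> with
  \<open>n < i \<le> n + m\<close>; either list may be empty.
\<close>

inductive AR :: "'a set \<Rightarrow> 'a fm \<Rightarrow> 'a fm \<Rightarrow> bool" for par :: "'a set" where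
  Ax: "IPC (A \<^bold>\<rightarrow> B) \<Longrightarrow> AR par A B"
| V: "B = Conjs (map (\<lambda>(E, F). E \<^bold>\<rightarrow> F) EFs) \<Longrightarrow> C = Disjs Es \<Longrightarrow>
      AR par (B \<^bold>\<rightarrow> C) (Disjs (map (bracket par B) (map fst EFs @ Es)))"
| sub: "substitution par \<theta> \<Longrightarrow> AR par A (subst \<theta> A)"
| Conj: "AR par A B \<Longrightarrow> AR par A C \<Longrightarrow> AR par A (B \<^bold>\<and> C)"
| Cut: "AR par A B \<Longrightarrow> AR par B C \<Longrightarrow> AR par A C"
| Disj: "AR par B A \<Longrightarrow> AR par C A \<Longrightarrow> AR par (B \<^bold>\<or> C) A"
| Mont: "p \<in> par \<Longrightarrow> AR par A B \<Longrightarrow> AR par (Atom p \<^bold>\<rightarrow> A) (Atom p \<^bold>\<rightarrow> B)"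

text \<open>
  \<open>is_star par A S\<close> collects the properties that specify \<open>A\<^sup>\<star>\<close>. They determine \<open>S\<close>
  only up to provable equivalence, so \<open>star\<close> picks some such formula; that it
  can be computed from \<open>A\<close> is not expressed.
\<close>

definition is_star :: "'a set \<Rightarrow> 'a fm \<Rightarrow> 'a fm \<Rightarrow> bool" where
  "is_star par A S \<longleftrightarrow>
     S \<in> NNIL_over par \<and> IPC (S \<^bold>\<rightarrow> A) \<and> AR par A S \<and> atoms S \<subseteq> atoms A"

definition star :: "'a set \<Rightarrow> 'a fm \<Rightarrow> 'a fm" where
  "star par A = (SOME S. is_star par A S)"

end

theory Submission
  imports Defs
begin

text \<open>
  Soundness: a set of NNIL formulas over the parameters that does not derive \<open>D\<close> extends to a
  maximal one \<open>\<Delta>\<close>, which decides NNIL disjunctions. Put a new root below all models of \<open>\<Delta>\<close>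
  (for V: of \<open>\<Delta>\<close> and \<open>B\<close>), forcing just the parameters derivable from \<open>\<Delta>\<close>. The root forces
  \<open>\<Delta>\<close> again, which yields the disjunction property and V.

  Completeness only needs a formula \<open>S\<close> with the properties of \<open>A\<^sup>\<star>\<close>. It is computed by a proof
  search in the style of the contraction-free sequent calculus. A variable in the antecedent is
  replaced by \<open>Top\<close>. When the antecedent consists of implications whose premises are atoms,
  \<open>Bot\<close> or implications, the search branches by V in a sharpened form, in which the bracket of a
  variable is \<open>Bot\<close>; the sharpening is derived from V and substitutions.
\<close>

section \<open>Derivability\<close>

lemma nd_mono: "nd H A \<Longrightarrow> H \<subseteq> H' \<Longrightarrow> nd H' A"
proof (induction arbitrary: H' rule: nd.induct)
  case (OrE H A B C)
  have "nd (insert A H') C" "nd (insert B H') C"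
    by (rule OrE.IH; use OrE.prems in blast)+
  then show ?case using OrE.IH(1)[OF OrE.prems] nd.OrE by blast
next
  case (ImpI A H B)
  have "nd (insert A H') B" by (rule ImpI.IH) (use ImpI.prems in blast)
  then show ?case by (rule nd.ImpI)
qed (metis nd.Assm subsetD, metis nd.BotE, metis nd.AndI, metis nd.AndE1, metis nd.AndE2, metis nd.OrI1, metis nd.OrI2, metis nd.ImpE)

lemma nd_insert: "nd H A \<Longrightarrow> nd (insert X H) A"
  by (erule nd_mono) blast

text \<open>Induction on the derivation replaces all hypotheses at once, so \<open>G\<close> may be
  infinite. A formula discharged by \<open>OrE\<close> or \<open>ImpI\<close> stays an assumption on
  both sides.\<close>

lemma nd_cuts: "nd G B \<Longrightarrow> (\<And>A. A \<in> G \<Longrightarrow> nd H A) \<Longrightarrow> nd H B"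
proof (induction arbitrary: H rule: nd.induct)
  case (OrE G A B C)
  have "nd (insert A H) C" "nd (insert B H) C"
    using OrE.IH(2,3) OrE.prems by (metis insertE insertI1 nd.Assm nd_insert)+
  then show ?case using OrE.IH(1)[OF OrE.prems] nd.OrE by blast
next
  case (ImpI A G B)
  have "nd (insert A H) B"
    using ImpI.IH ImpI.prems by (metis insertE insertI1 nd.Assm nd_insert)
  then show ?case by (rule nd.ImpI)
qed (metis, metis nd.BotE, metis nd.AndI, metis nd.AndE1, metis nd.AndE2, metis nd.OrI1, metis nd.OrI2, metis nd.ImpE)

lemma nd_Imp_iff: "nd H (A \<^bold>\<rightarrow> B) \<longleftrightarrow> nd (insert A H) B"
proof
  assume "nd H (A \<^bold>\<rightarrow> B)"
  then have "nd (insert A H) (A \<^bold>\<rightarrow> B)" by (rule nd_mono) blast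
  then show "nd (insert A H) B" by (rule nd.ImpE) (simp add: nd.Assm)
qed (rule nd.ImpI)

lemma nd_And_iff: "nd H (A \<^bold>\<and> B) \<longleftrightarrow> nd H A \<and> nd H B"
  by (blast intro: nd.AndI nd.AndE1 nd.AndE2)

lemma nd_Top: "nd H Top"
  by (simp add: nd_Imp_iff nd.Assm)

lemma nd_cut: "nd H A \<Longrightarrow> nd (insert A H) B \<Longrightarrow> nd H B"
  by (blast intro: nd.ImpE nd.ImpI)

lemma IPC_Imp_iff: "IPC (A \<^bold>\<rightarrow> B) \<longleftrightarrow> nd {A} B"
  by (simp add: IPC_def nd_Imp_iff)

lemma nd_subst: "nd H A \<Longrightarrow> nd (subst \<theta> ` H) (subst \<theta> A)"
  by (induction rule: nd.induct)
    (simp_all, (metis nd.intros image_eqI)+)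

text \<open>Compactness, needed for unions of chains when Zorn's lemma is applied.\<close>

lemma nd_finite: "nd H A \<Longrightarrow> \<exists>F\<subseteq>H. finite F \<and> nd F A"
proof (induction rule: nd.induct)
  case (Assm A H)
  then show ?case by (intro exI[of _ "{A}"]) (auto intro: nd.Assm)
next
  case (AndI H A B)
  then obtain F G where "F \<subseteq> H" "finite F" "nd F A" "G \<subseteq> H" "finite G" "nd G B" by blast
  then show ?case
    by (intro exI[of _ "F \<union> G"]) (auto intro: nd.AndI elim: nd_mono)
next
  case (OrE H A B C)
  then obtain F G K where *: "F \<subseteq> H" "finite F" "nd F (A \<^bold>\<or> B)" "G \<subseteq> insert A H" "finite G" "nd G C"
    "K \<subseteq> insert B H" "finite K" "nd K C" by blast
  let ?F = "F \<union> (G - {A}) \<union> (K - {B})"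
  have "nd ?F (A \<^bold>\<or> B)" "nd (insert A ?F) C" "nd (insert B ?F) C"
    using * by (auto elim: nd_mono)
  then have "nd ?F C" by (rule nd.OrE)
  then show ?case using * by (intro exI[of _ ?F]) auto
next
  case (ImpI A H B)
  then obtain G where *: "G \<subseteq> insert A H" "finite G" "nd G B" by blast
  then have "nd (insert A (G - {A})) B" by (auto elim: nd_mono)
  then show ?case using * by (intro exI[of _ "G - {A}"]) (auto intro: nd.ImpI)
next
  case (ImpE H A B)
  then obtain F G where "F \<subseteq> H" "finite F" "nd F (A \<^bold>\<rightarrow> B)" "G \<subseteq> H" "finite G" "nd G A" by blast
  then show ?case
    by (intro exI[of _ "F \<union> G"]) (auto intro: nd.ImpE elim: nd_mono)
qed (metis nd.BotE nd.AndE1 nd.AndE2 nd.OrI1 nd.OrI2)+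

section \<open>Finite conjunctions and disjunctions\<close>

lemma nd_Conjs_iff: "nd H (Conjs As) \<longleftrightarrow> (\<forall>A\<in>set As. nd H A)"
  by (induction As rule: Conjs.induct) (auto simp: nd_And_iff nd_Top)

lemma nd_Conjs_Imp_iff: "nd H (Conjs As \<^bold>\<rightarrow> C) \<longleftrightarrow> nd (set As \<union> H) C"
proof -
  have "nd (insert (Conjs As) H) A" if "A \<in> set As \<union> H" for A
    using that nd_Conjs_iff[of "insert (Conjs As) H" As] by (auto simp: nd.Assm)
  moreover have "nd (set As \<union> H) A" if "A \<in> insert (Conjs As) H" for A
    using that by (auto simp: nd.Assm nd_Conjs_iff)
  ultimately show ?thesis unfolding nd_Imp_iff using nd_cuts by metis
qed

lemma nd_Disjs: "A \<in> set As \<Longrightarrow> nd H A \<Longrightarrow> nd H (Disjs As)"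
  by (induction As rule: Disjs.induct) (auto intro: nd.OrI1 nd.OrI2)

lemma nd_DisjsE:
  "nd H (Disjs As) \<Longrightarrow> (\<And>A. A \<in> set As \<Longrightarrow> nd (insert A H) C) \<Longrightarrow> nd H C"
proof (induction As arbitrary: H rule: Disjs.induct)
  case 1
  then show ?case using nd.BotE[of H C] by simp
next
  case (2 A)
  then show ?case using nd_cut[of H A C] by simp
next
  case (3 A B As)
  have "nd (insert (Disjs (B # As)) H) C"
  proof (rule "3.IH")
    show "nd (insert D (insert (Disjs (B # As)) H)) C" if "D \<in> set (B # As)" for D
      by (rule nd_mono[OF "3.prems"(2)]) (use that in auto)
  qed (simp add: nd.Assm)
  moreover have "nd (insert A H) C" using "3.prems"(2) by simp
  ultimately show ?case using "3.prems"(1) nd.OrE[of H A "Disjs (B # As)" C] by simp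
qed

lemma atoms_Conjs: "atoms (Conjs As) = (\<Union>A\<in>set As. atoms A)"
  by (induction As rule: Conjs.induct) auto

lemma atoms_Disjs: "atoms (Disjs As) = (\<Union>A\<in>set As. atoms A)"
  by (induction As rule: Disjs.induct) auto

lemma subst_Conjs: "subst \<theta> (Conjs As) = Conjs (map (subst \<theta>) As)"
  by (induction As rule: Conjs.induct) auto

text \<open>Replacement of equivalents relative to the hypotheses \<open>H\<close>. Both directions
  go through one induction because an implication reverses the direction for its premise.\<close>

lemma nd_subst_equiv:
  assumes "\<And>a. nd (insert (Atom a) H) (\<theta> a)" "\<And>a. nd (insert (\<theta> a) H) (Atom a)"
  shows "nd (insert A H) (subst \<theta> A) \<and> nd (insert (subst \<theta> A) H) A"
proof (induction A)
  case (And A B)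
  let ?H = "insert (A \<^bold>\<and> B) H" and ?I = "insert (subst \<theta> A \<^bold>\<and> subst \<theta> B) H"
  have "nd ?H A" "nd ?H B" "nd ?I (subst \<theta> A)" "nd ?I (subst \<theta> B)"
    by (auto intro: nd.Assm nd.AndE1 nd.AndE2)
  moreover have "nd (insert A ?H) (subst \<theta> A)" "nd (insert B ?H) (subst \<theta> B)"
    "nd (insert (subst \<theta> A) ?I) A" "nd (insert (subst \<theta> B) ?I) B"
    using And by (auto elim: nd_mono)
  ultimately show ?case by (auto simp: nd_And_iff dest: nd_cut)
next
  case (Or A B)
  let ?H = "insert (A \<^bold>\<or> B) H" and ?I = "insert (subst \<theta> A \<^bold>\<or> subst \<theta> B) H"
  have "nd (insert A ?H) (subst \<theta> A)" "nd (insert B ?H) (subst \<theta> B)"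
    "nd (insert (subst \<theta> A) ?I) A" "nd (insert (subst \<theta> B) ?I) B"
    using Or by (auto elim: nd_mono)
  moreover have "nd ?H (A \<^bold>\<or> B)" "nd ?I (subst \<theta> A \<^bold>\<or> subst \<theta> B)"
    by (rule nd.Assm, blast)+
  ultimately have "nd ?H (subst \<theta> A \<^bold>\<or> subst \<theta> B)" "nd ?I (A \<^bold>\<or> B)"
    by (blast intro: nd.OrE[of ?H A B] nd.OrI1 nd.OrI2, 
        blast intro: nd.OrE[of ?I "subst \<theta> A" "subst \<theta> B"] nd.OrI1 nd.OrI2)
  then show ?case by simp
next
  case (Imp A B)
  have "nd (insert (subst \<theta> A) (insert (A \<^bold>\<rightarrow> B) H)) A" using Imp by (auto elim: nd_mono)
  then have "nd (insert (subst \<theta> A) (insert (A \<^bold>\<rightarrow> B) H)) B"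
    by (rule nd.ImpE[rotated]) (simp add: nd.Assm)
  then have 1: "nd (insert (subst \<theta> A) (insert (A \<^bold>\<rightarrow> B) H)) (subst \<theta> B)"
    by (rule nd_cut) (use Imp in \<open>auto elim: nd_mono\<close>)
  let ?I = "subst \<theta> A \<^bold>\<rightarrow> subst \<theta> B"
  have "nd (insert A (insert ?I H)) (subst \<theta> A)" using Imp by (auto elim: nd_mono)
  then have "nd (insert A (insert ?I H)) (subst \<theta> B)"
    by (rule nd.ImpE[rotated]) (simp add: nd.Assm)
  then have "nd (insert A (insert ?I H)) B"
    by (rule nd_cut) (use Imp in \<open>auto elim: nd_mono\<close>)
  with 1 show ?case by (simp add: nd_Imp_iff)
next
  case Bot
  then show ?case by (simp add: nd.Assm)
qed (use assms in auto)

text \<open>Under \<open>H\<close> every atom that is moved is equivalent to \<open>Top\<close>, and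
  so is its value; replacement of equivalents then applies.\<close>

lemma nd_subst_iff:
  assumes "\<And>a. \<theta> a = Atom a \<or> nd H (Atom a) \<and> nd H (\<theta> a)"
  shows "nd H (subst \<theta> A) \<longleftrightarrow> nd H A"
proof -
  have "nd (insert (Atom a) H) (\<theta> a) \<and> nd (insert (\<theta> a) H) (Atom a)" for a
    using assms[of a] by (auto intro: nd.Assm elim: nd_mono)
  then have "nd (insert A H) (subst \<theta> A) \<and> nd (insert (subst \<theta> A) H) A"
    by (intro nd_subst_equiv) auto
  then show ?thesis by (blast intro: nd_cut)
qed

section \<open>Soundness for preservativity\<close>

lemma NNIL_over_And: "A \<in> NNIL_over par \<Longrightarrow> B \<in> NNIL_over par \<Longrightarrow> A \<^bold>\<and> B \<in> NNIL_over par"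
  by (simp add: NNIL_over_def NNIL.intros)

lemma NNIL_over_Or: "A \<in> NNIL_over par \<Longrightarrow> B \<in> NNIL_over par \<Longrightarrow> A \<^bold>\<or> B \<in> NNIL_over par"
  by (simp add: NNIL_over_def NNIL.intros)

lemma NNIL_over_Bot: "Bot \<in> NNIL_over par"
  by (auto simp: NNIL_over_def intro: NNIL.intros)

lemma NNIL_over_Top: "Top \<in> NNIL_over par"
  by (auto simp: NNIL_over_def intro: NNIL.intros)

lemma NNIL_over_Atom: "p \<in> par \<Longrightarrow> Atom p \<in> NNIL_over par"
  by (auto simp: NNIL_over_def intro: NNIL.intros)

lemma NNIL_over_Imp: "p \<in> par \<Longrightarrow> A \<in> NNIL_over par \<Longrightarrow> Atom p \<^bold>\<rightarrow> A \<in> NNIL_over par"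
  by (simp add: NNIL_over_def NNIL.intros positive.intros)

lemma NNIL_over_Disjs: "set As \<subseteq> NNIL_over par \<Longrightarrow> Disjs As \<in> NNIL_over par"
  by (induction As rule: Disjs.induct) (simp_all add: NNIL_over_Bot NNIL_over_Or)

section \<open>Maximal sets and forcing at a new root\<close>

lemma lindenbaum:
  assumes "\<Gamma> \<subseteq> N" "\<not> nd \<Gamma> D"
  obtains \<Delta> where "\<Gamma> \<subseteq> \<Delta>" "\<Delta> \<subseteq> N" "\<not> nd \<Delta> D" "\<forall>X\<in>N - \<Delta>. nd (insert X \<Delta>) D"
proof -
  let ?\<A> = "{\<Delta>. \<Gamma> \<subseteq> \<Delta> \<and> \<Delta> \<subseteq> N \<and> \<not> nd \<Delta> D}"
  have "\<exists>M\<in>?\<A>. \<forall>X\<in>?\<A>. M \<subseteq> X \<longrightarrow> X = M"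
  proof (rule subset_Zorn_nonempty)
    show "?\<A> \<noteq> {}" using assms by blast
    fix \<C> assume \<C>: "\<C> \<noteq> {}" "subset.chain ?\<A> \<C>"
    \<comment> \<open>A derivation from the union uses finitely many formulas, and these lie in a
      single member of the chain.\<close>
    have "\<not> nd (\<Union>\<C>) D"
    proof
      assume "nd (\<Union>\<C>) D"
      then obtain F where F: "finite F" "F \<subseteq> \<Union>\<C>" "nd F D" using nd_finite by blast
      obtain \<Delta> where "\<Delta> \<in> \<C>" "F \<subseteq> \<Delta>"
        using finite_subset_Union_chain[OF F(1,2) \<C>] by blast
      then have "nd \<Delta> D" "\<Delta> \<in> ?\<A>" using F(3) nd_mono \<C>(2) by (auto simp: subset.chain_def)
      then show False by blast
    qed
    then show "\<Union>\<C> \<in> ?\<A>" using \<C> by (auto simp: subset.chain_def)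
  qed
  then obtain \<Delta> where \<Delta>: "\<Delta> \<in> ?\<A>" "\<forall>X\<in>?\<A>. \<Delta> \<subseteq> X \<longrightarrow> X = \<Delta>"
    by (rule bexE)
  have "nd (insert X \<Delta>) D" if "X \<in> N" "X \<notin> \<Delta>" for X
  proof (rule ccontr)
    assume "\<not> nd (insert X \<Delta>) D"
    then have "insert X \<Delta> = \<Delta>" using \<Delta>(1) that(1) by (intro \<Delta>(2)[rule_format]) auto
    then show False using that(2) by blast
  qed
  with \<Delta>(1) show ?thesis by (intro that[of \<Delta>]) auto
qed

text \<open>Aczel's slash: forcing at a new root, with valuation \<open>v\<close>, put below all models of \<open>T\<close>.\<close>

primrec slash :: "'a fm set \<Rightarrow> ('a \<Rightarrow> bool) \<Rightarrow> 'a fm \<Rightarrow> bool" where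
  "slash T v (Atom a) \<longleftrightarrow> v a"
| "slash T v Bot \<longleftrightarrow> False"
| "slash T v (A \<^bold>\<and> B) \<longleftrightarrow> slash T v A \<and> slash T v B"
| "slash T v (A \<^bold>\<or> B) \<longleftrightarrow> slash T v A \<or> slash T v B"
| "slash T v (A \<^bold>\<rightarrow> B) \<longleftrightarrow> nd T (A \<^bold>\<rightarrow> B) \<and> (slash T v A \<longrightarrow> slash T v B)"

lemma slash_Conjs: "slash T v (Conjs As) \<longleftrightarrow> (\<forall>A\<in>set As. slash T v A)"
  by (induction As rule: Conjs.induct) (auto simp: nd_Top)

lemma slash_Disjs: "slash T v (Disjs As) \<longleftrightarrow> (\<exists>A\<in>set As. slash T v A)"
  by (induction As rule: Disjs.induct) auto

lemma slash_imp_nd: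
  assumes "slash T v A" "\<And>a. v a \<Longrightarrow> nd T (Atom a)"
  shows "nd T A"
  using assms(1) by (induction A) (auto intro: assms(2) nd.AndI nd.OrI1 nd.OrI2)

text \<open>Forcing an implication also demands that \<open>T\<close> derives it. For
  \<open>ImpI\<close> this holds because forced hypotheses are derivable from \<open>T\<close> and
  can be cut out of the given derivation.\<close>

lemma slash_sound:
  assumes v: "\<And>a. v a \<Longrightarrow> nd T (Atom a)"
  shows "nd H A \<Longrightarrow> (\<And>X. X \<in> H \<Longrightarrow> slash T v X) \<Longrightarrow> slash T v A"
proof (induction rule: nd.induct)
  case (ImpI A H B)
  have "nd (insert A T) B"
    by (rule nd_cuts[OF ImpI.hyps])
      (auto intro: nd.Assm elim: nd_mono[OF slash_imp_nd[OF ImpI.prems v]])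
  then show ?case using ImpI by (auto simp: nd_Imp_iff)
qed auto

text \<open>Apart from \<open>Top\<close> no implication occurs in \<open>A\<close>, so the
  valuation alone decides the forcing. This yields derivability from \<Delta>, whereas
  \<open>slash_imp_nd\<close> would only give it from the possibly larger \<open>T\<close>.\<close>

lemma slash_positive:
  assumes "A \<in> positive" "slash T (\<lambda>a. a \<in> par \<and> nd \<Delta> (Atom a)) A"
  shows "nd \<Delta> A"
  using assms by (induction rule: positive.induct) (auto intro: nd.AndI nd.OrI1 nd.OrI2 nd_Top)

text \<open>NNIL formulas survive the addition of the root because a positive premise forced there
  is already derivable from \<open>\<Delta>\<close>.\<close>

lemma slash_NNIL:
  assumes "\<Delta> \<subseteq> T" "\<not> nd \<Delta> Bot"
    and prime: "\<And>X Y. X \<in> NNIL_over par \<Longrightarrow> Y \<in> NNIL_over par \<Longrightarrow> nd \<Delta> (X \<^bold>\<or> Y) \<Longrightarrow> nd \<Delta> X \<or> nd \<Delta> Y"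
    and "A \<in> NNIL" "atoms A \<subseteq> par" "nd \<Delta> A"
  shows "slash T (\<lambda>a. a \<in> par \<and> nd \<Delta> (Atom a)) A"
  using assms(4-6)
proof (induction rule: NNIL.induct)
  case 3
  then show ?case by (simp add: nd_Top)
next
  case (4 A B)
  then show ?case by (simp add: nd_And_iff)
next
  case (5 A B)
  then show ?case using prime[of A B] by (auto simp: NNIL_over_def)
next
  case (6 B C)
  have "nd \<Delta> C" if "slash T (\<lambda>a. a \<in> par \<and> nd \<Delta> (Atom a)) B"
    using slash_positive[OF 6(1) that] 6(5) by (rule nd.ImpE[rotated])
  then show ?case using 6 assms(1) by (auto elim: nd_mono)
qed (use assms(2) in auto)

text \<open>By maximality \<Delta> is prime for NNIL disjunctions: if both disjuncts were missing,
  each would derive \<open>D\<close> over \<Delta>, and so would the disjunction. The set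
  \<open>T\<close> stays arbitrary because V takes \<Delta> with \<open>B\<close> added, while
  \<open>Disj\<close> takes \<Delta> itself.\<close>

lemma slashed_extension:
  assumes "\<Gamma> \<subseteq> NNIL_over par" "\<not> nd \<Gamma> D"
  obtains \<Delta> where "\<Gamma> \<subseteq> \<Delta>" "\<Delta> \<subseteq> NNIL_over par" "\<not> nd \<Delta> D"
    "\<forall>T X. \<Delta> \<subseteq> T \<longrightarrow> X \<in> \<Delta> \<longrightarrow> slash T (\<lambda>a. a \<in> par \<and> nd \<Delta> (Atom a)) X"
proof -
  obtain \<Delta> where \<Delta>: "\<Gamma> \<subseteq> \<Delta>" "\<Delta> \<subseteq> NNIL_over par" "\<not> nd \<Delta> D"
    "\<forall>X\<in>NNIL_over par - \<Delta>. nd (insert X \<Delta>) D"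
    by (rule lindenbaum[OF assms])
  have bot: "\<not> nd \<Delta> Bot" using \<Delta>(3) nd.BotE by blast
  have prime: "nd \<Delta> X \<or> nd \<Delta> Y"
    if "X \<in> NNIL_over par" "Y \<in> NNIL_over par" "nd \<Delta> (X \<^bold>\<or> Y)" for X Y
    using that \<Delta>(3,4) nd.OrE nd.Assm by (metis DiffI)
  have "slash T (\<lambda>a. a \<in> par \<and> nd \<Delta> (Atom a)) X" if "\<Delta> \<subseteq> T" "X \<in> \<Delta>" for T X
    by (rule slash_NNIL[OF that(1) bot prime])
      (use that(2) \<Delta>(2) in \<open>auto simp: NNIL_over_def nd.Assm\<close>)
  with \<Delta>(1-3) that show ?thesis by simp
qed

text \<open>Suppose no disjunct of the conclusion follows from \<Delta>. Then no \<open>E\<close> is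
  forced at a root below the models of \<Delta> and \<open>B\<close>, so the implications in
  \<open>B\<close> hold there vacuously. Hence \<open>B\<close> is forced, and with it
  \<open>C\<close>; but then some \<open>E\<close> from \<open>Es\<close> is forced.\<close>

lemma nd_V:
  assumes \<Gamma>: "\<Gamma> \<subseteq> NNIL_over par"
    and B: "B = Conjs (map (\<lambda>(E, F). E \<^bold>\<rightarrow> F) EFs)" and C: "C = Disjs Es"
    and nd: "nd \<Gamma> (B \<^bold>\<rightarrow> C)"
  shows "nd \<Gamma> (Disjs (map (bracket par B) (map fst EFs @ Es)))" (is "nd \<Gamma> ?D")
proof (rule ccontr)
  assume "\<not> nd \<Gamma> ?D"
  then obtain \<Delta> where \<Delta>: "\<Gamma> \<subseteq> \<Delta>" "\<Delta> \<subseteq> NNIL_over par" "\<not> nd \<Delta> ?D"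
    "\<forall>T X. \<Delta> \<subseteq> T \<longrightarrow> X \<in> \<Delta> \<longrightarrow> slash T (\<lambda>a. a \<in> par \<and> nd \<Delta> (Atom a)) X"
    by (rule slashed_extension[OF \<Gamma>])
  let ?v = "\<lambda>a. a \<in> par \<and> nd \<Delta> (Atom a)" and ?T = "insert B \<Delta>"
  have v: "nd ?T (Atom a)" if "?v a" for a using that by (auto elim: nd_mono)
  have not: "\<not> slash ?T ?v E" if "E \<in> set (map fst EFs @ Es)" for E
  proof
    assume s: "slash ?T ?v E"
    have "nd ?T E" by (rule slash_imp_nd[OF s v])
    \<comment> \<open>A parameter forced at the root is derivable from \<Delta> without
      \<open>B\<close>, which is why its bracket needs no premise \<open>B\<close>.
      \<open>Bot\<close> is never forced.\<close>
    with s have "nd \<Delta> (bracket par B E)" by (auto simp: bracket_def nd_Imp_iff)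
    moreover have "bracket par B E \<in> set (map (bracket par B) (map fst EFs @ Es))"
      using that by auto
    ultimately have "nd \<Delta> ?D" using nd_Disjs by metis
    with \<Delta>(3) show False by blast
  qed
  have "slash ?T ?v (E \<^bold>\<rightarrow> F)" if "(E, F) \<in> set EFs" for E F
  proof -
    have "nd ?T (Conjs (map (\<lambda>(E, F). E \<^bold>\<rightarrow> F) EFs))" using B by (auto intro: nd.Assm)
    then have "nd ?T (E \<^bold>\<rightarrow> F)" using that by (auto simp: nd_Conjs_iff)
    then show ?thesis using not[of E] that by force
  qed
  then have "slash ?T ?v B" unfolding B slash_Conjs by auto
  moreover have "nd ?T C" using nd \<Delta>(1) by (auto simp: nd_Imp_iff elim: nd_mono)
  moreover have "slash ?T ?v X" if "X \<in> \<Delta>" for X using that \<Delta>(4) by blast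
  ultimately have "slash ?T ?v C" using slash_sound[of ?v ?T ?T C] v by blast
  then show False using not unfolding C slash_Disjs by auto
qed

text \<open>Over a maximal \<Delta> the root forces one of the disjuncts, and what it forces is
  derivable from \<Delta>. So the disjunction property holds for arbitrary \<open>B\<close> and
  \<open>C\<close>, not only for NNIL formulas.\<close>

lemma nd_NNIL_Or:
  assumes \<Gamma>: "\<Gamma> \<subseteq> NNIL_over par" and nd: "nd \<Gamma> (B \<^bold>\<or> C)"
    and BC: "\<And>\<Delta>. \<Delta> \<subseteq> NNIL_over par \<Longrightarrow> nd \<Delta> B \<or> nd \<Delta> C \<Longrightarrow> nd \<Delta> A"
  shows "nd \<Gamma> A"
proof (rule ccontr)
  assume "\<not> nd \<Gamma> A"
  then obtain \<Delta> where \<Delta>: "\<Gamma> \<subseteq> \<Delta>" "\<Delta> \<subseteq> NNIL_over par" "\<not> nd \<Delta> A"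
    "\<forall>T X. \<Delta> \<subseteq> T \<longrightarrow> X \<in> \<Delta> \<longrightarrow> slash T (\<lambda>a. a \<in> par \<and> nd \<Delta> (Atom a)) X"
    by (rule slashed_extension[OF \<Gamma>])
  let ?v = "\<lambda>a. a \<in> par \<and> nd \<Delta> (Atom a)"
  have "slash \<Delta> ?v X" if "X \<in> \<Delta>" for X using that \<Delta>(4) by blast
  then have "slash \<Delta> ?v (B \<^bold>\<or> C)"
    using slash_sound[of ?v \<Delta> \<Delta> "B \<^bold>\<or> C"] nd_mono[OF nd \<Delta>(1)] by blast
  then have "slash \<Delta> ?v B \<or> slash \<Delta> ?v C" by simp
  moreover have "nd \<Delta> X" if "slash \<Delta> ?v X" for X using that by (rule slash_imp_nd) simp
  ultimately have "nd \<Delta> B \<or> nd \<Delta> C" by blast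
  then show False using BC[OF \<Delta>(2)] \<Delta>(3) by blast
qed

lemma subst_fixed: "substitution par \<theta> \<Longrightarrow> atoms A \<subseteq> par \<Longrightarrow> subst \<theta> A = A"
  by (induction A) (simp_all add: substitution_def)

text \<open>Sets of NNIL formulas replace the single test formula so that the induction goes
  through: \<open>Disj\<close> passes to a maximal extension, and \<open>Mont\<close> adds the
  parameter to the set.\<close>

lemma AR_sound: "AR par A B \<Longrightarrow> \<Gamma> \<subseteq> NNIL_over par \<Longrightarrow> nd \<Gamma> A \<Longrightarrow> nd \<Gamma> B"
proof (induction arbitrary: \<Gamma> rule: AR.induct)
  case (Ax A B)
  then have "nd (insert A \<Gamma>) B" by (auto simp: IPC_Imp_iff elim: nd_mono)
  with Ax show ?case by (blast intro: nd_cut)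
next
  case (V B EFs C Es)
  then show ?case using nd_V by metis
next
  case (sub \<theta> A)
  have "subst \<theta> ` \<Gamma> = \<Gamma>"
  proof -
    have "subst \<theta> A = A" if "A \<in> \<Gamma>" for A
      using that sub by (intro subst_fixed) (auto simp: NNIL_over_def)
    then show ?thesis by simp
  qed
  then show ?case using nd_subst[OF sub(3), of \<theta>] by simp
next
  case (Disj B A C)
  show ?case by (rule nd_NNIL_Or[OF Disj.prems]) (use Disj.IH in blast)
next
  case (Mont p A B)
  have "nd (insert (Atom p) \<Gamma>) B"
    using Mont NNIL_over_Atom by (intro Mont.IH) (auto simp: nd_Imp_iff)
  then show ?case by (rule nd.ImpI)
qed (auto intro: nd.AndI)

lemma AR_preservativity: "AR par A B \<Longrightarrow> preservativity (NNIL_over par) A B"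
  unfolding preservativity_def IPC_Imp_iff using AR_sound[of par A B] by simp

section \<open>Derived preservativity rules\<close>

lemma AR_nd: "nd {A} B \<Longrightarrow> AR par A B"
  by (simp add: AR.Ax IPC_Imp_iff)

lemma AR_nd_trans: "nd {A} B \<Longrightarrow> AR par B C \<Longrightarrow> AR par A C"
  by (blast intro: AR.Cut AR_nd)

lemma nd_AndD1: "nd {A \<^bold>\<and> B} A"
  by (rule nd.AndE1[of _ _ B]) (simp add: nd.Assm)

lemma nd_AndD2: "nd {A \<^bold>\<and> B} B"
  by (rule nd.AndE2[of _ A]) (simp add: nd.Assm)

lemma nd_trans: "nd H A \<Longrightarrow> nd {A} B \<Longrightarrow> nd H B"
  by (erule nd_cut) (erule nd_mono, blast)

text \<open>Since \<open>Conj\<close> keeps the premise available, a preservativity step can be made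
  on one conjunct only. This allows a substitution to act on \<open>Y\<close> while the context
  \<open>X\<close> is left untouched.\<close>

lemma AR_And_right:
  assumes "AR par Y Z" "AR par (X \<^bold>\<and> Z) D"
  shows "AR par (X \<^bold>\<and> Y) D"
proof (rule AR.Cut[OF AR.Conj assms(2)])
  show "AR par (X \<^bold>\<and> Y) X" by (rule AR_nd[OF nd_AndD1])
  show "AR par (X \<^bold>\<and> Y) Z" by (rule AR_nd_trans[OF nd_AndD2 assms(1)])
qed

lemma AR_Disjs: "(\<And>A. A \<in> set As \<Longrightarrow> AR par A D) \<Longrightarrow> AR par (Disjs As) D"
proof (induction As rule: Disjs.induct)
  case 1
  have "nd {Bot} D" by (rule nd.BotE) (simp add: nd.Assm)
  then show ?case by (simp add: AR_nd)
qed (auto intro: AR.Disj)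

lemma AR_And_Disjs:
  assumes "\<And>A. A \<in> set As \<Longrightarrow> AR par (X \<^bold>\<and> A) D"
  shows "AR par (X \<^bold>\<and> Disjs As) D"
proof (rule AR_nd_trans)
  show "AR par (Disjs (map ((\<^bold>\<and>) X) As)) D" by (rule AR_Disjs) (use assms in auto)
  let ?H = "{X \<^bold>\<and> Disjs As}"
  show "nd ?H (Disjs (map ((\<^bold>\<and>) X) As))"
  proof (rule nd_DisjsE[OF nd_AndD2])
    fix A assume "A \<in> set As"
    moreover have "nd (insert A ?H) (X \<^bold>\<and> A)"
      by (intro nd.AndI nd_insert[OF nd_AndD1]) (simp add: nd.Assm)
    ultimately show "nd (insert A ?H) (Disjs (map ((\<^bold>\<and>) X) As))"
      by (intro nd_Disjs[of "X \<^bold>\<and> A"]) auto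
  qed
qed

text \<open>V read as a branching rule for a proof search: each branch retains \<open>X\<close>
  besides its own bracket.\<close>

lemma AR_V:
  assumes "B = Conjs (map (\<lambda>(E, F). E \<^bold>\<rightarrow> F) EFs)" "AR par X (B \<^bold>\<rightarrow> Disjs Es)"
    and "\<And>E. E \<in> set (map fst EFs @ Es) \<Longrightarrow> AR par (X \<^bold>\<and> bracket par B E) D"
  shows "AR par X D"
proof (rule AR.Cut)
  show "AR par X (X \<^bold>\<and> Disjs (map (bracket par B) (map fst EFs @ Es)))"
    by (intro AR.Conj AR.Cut[OF assms(2) AR.V[OF assms(1)]]) (simp_all add: AR_nd nd.Assm)
  show "AR par (X \<^bold>\<and> Disjs (map (bracket par B) (map fst EFs @ Es))) D"
    using assms(3) by (intro AR_And_Disjs) auto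
qed

lemma AR_And_Bot: "AR par (X \<^bold>\<and> Bot) D"
  by (rule AR_nd[OF nd.BotE[OF nd_AndD2]])

lemma AR_And_weaken:
  assumes "AR par (X \<^bold>\<and> A) D" "nd {Y} X" "nd {Y \<^bold>\<and> A'} A"
  shows "AR par (Y \<^bold>\<and> A') D"
  using assms(1) by (rule AR_nd_trans[rotated]) (intro nd.AndI nd_trans[OF nd_AndD1] assms(2,3))

lemma subst_subst: "subst \<sigma> (subst \<theta> A) = subst (\<lambda>a. subst \<sigma> (\<theta> a)) A"
  by (induction A) auto

text \<open>The rule V says nothing new about \<open>B \<^bold>\<rightarrow> Atom z\<close> for a variable \<open>z\<close>. Substituting
  \<open>z \<or> \<not> z\<close> for \<open>z\<close> first makes it split the conclusion, and the resulting disjuncts are then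
  returned to the original ones by substituting a truth constant for \<open>z\<close>, which under \<open>B\<close> is
  equivalent to \<open>Top\<close>. The set \<open>Z\<close> collects the variables known to follow from \<open>B\<close>.\<close>

lemma AR_Imp_variable:
  fixes par :: "'a::finite set"
  assumes B: "B = Conjs (map (\<lambda>(E, F). E \<^bold>\<rightarrow> F) EFs)"
    and Dn: "\<And>E. E \<in> fst ` set EFs \<Longrightarrow> E \<notin> range Atom \<Longrightarrow> E \<noteq> Bot \<Longrightarrow> AR par (X \<^bold>\<and> (B \<^bold>\<rightarrow> E)) D"
    and Dp: "\<And>p. Atom p \<in> fst ` set EFs \<Longrightarrow> p \<in> par \<Longrightarrow> AR par (X \<^bold>\<and> Atom p) D"
    and Db: "AR par (X \<^bold>\<and> (B \<^bold>\<rightarrow> Bot)) D"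
    and "z0 \<in> Z" "Z \<inter> par = {}" "nd {Y} X" "\<And>z. z \<in> Z \<Longrightarrow> nd {Y} (B \<^bold>\<rightarrow> Atom z)"
  shows "AR par Y D"
  using assms(5-8)
\<comment> \<open>A branch that yields a new variable enlarges \<open>Z\<close>, which is bounded
  because there are finitely many atoms. \<open>Y\<close> varies because such a branch also adds an
  assumption.\<close>
proof (induction "card (- Z)" arbitrary: Z Y rule: less_induct)
  case less
  define \<theta> where "\<theta> = (\<lambda>a. if a \<in> Z then Atom a \<^bold>\<or> (Atom a \<^bold>\<rightarrow> Bot) else Atom a)"
  define \<sigma> where "\<sigma> = (\<lambda>c a. if a \<in> Z then c else Atom a :: 'a fm)"
  \<comment> \<open>A premise \<open>z\<close> becomes \<open>z \<or> \<not>z\<close> under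
    \<open>\<theta>\<close>. Splitting that implication in two makes V offer \<open>z\<close> and
    \<open>\<not>z\<close> as separate disjuncts.\<close>
  define g where "g = (\<lambda>(E, F).
    if E \<in> Atom ` Z then [(E, subst \<theta> F), (E \<^bold>\<rightarrow> Bot, subst \<theta> F)]
    else [(subst \<theta> E, subst \<theta> F)])"
  define EFs2 where "EFs2 = concat (map g EFs)"
  define B2 where "B2 = Conjs (map (\<lambda>(E, F). E \<^bold>\<rightarrow> F) EFs2)"
  have \<theta>: "substitution par \<theta>" and \<sigma>: "substitution par (\<sigma> c)" for c
    using less.prems(2) by (auto simp: substitution_def \<theta>_def \<sigma>_def)
  have HZ: "nd H (Atom z)" if "nd H Y" "nd H B" "z \<in> Z" for H z
    using nd_trans[OF that(1) less.prems(4)[OF that(3)]] that(2) by (rule nd.ImpE)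
  \<comment> \<open>Under \<open>Y\<close> and \<open>B\<close> each \<open>z\<close> in
    \<open>Z\<close> holds, and its image \<open>c \<or> \<not>c\<close> holds for either truth
    constant, so the two substitutions together change nothing.\<close>
  have H\<sigma>: "nd H (subst (\<sigma> c) (subst \<theta> A)) \<longleftrightarrow> nd H A"
    if "nd H Y" "nd H B" "c \<in> {Top, Bot}" for H c A
    unfolding subst_subst
  proof (rule nd_subst_iff)
    fix a
    have "nd H (c \<^bold>\<or> (c \<^bold>\<rightarrow> Bot))"
      using that(3) nd_Top[of H] by (auto intro: nd.OrI1 nd.OrI2)
    then show "subst (\<sigma> c) (\<theta> a) = Atom a \<or> nd H (Atom a) \<and> nd H (subst (\<sigma> c) (\<theta> a))"
      using HZ[OF that(1,2)] by (simp add: \<theta>_def \<sigma>_def)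
  qed
  have EFs2_cases: "\<exists>E F. (E, F) \<in> set EFs \<and> F' = subst \<theta> F \<and>
      ((\<exists>z\<in>Z. E = Atom z \<and> (E' = Atom z \<or> E' = Atom z \<^bold>\<rightarrow> Bot)) \<or>
       E \<notin> Atom ` Z \<and> E' = subst \<theta> E)" if *: "(E', F') \<in> set EFs2" for E' F'
  proof -
    obtain E F where "(E, F) \<in> set EFs" "(E', F') \<in> set (g (E, F))"
      using * unfolding EFs2_def by auto
    then show ?thesis by (cases "E \<in> Atom ` Z") (auto simp: g_def)
  qed
  have HB2: "nd H (subst (\<sigma> c) B2)" if H: "nd H Y" "nd H B" "c \<in> {Top, Bot}" for H c
  proof -
    have "nd H (subst (\<sigma> c) E' \<^bold>\<rightarrow> subst (\<sigma> c) F')" if *: "(E', F') \<in> set EFs2" for E' F'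
    proof -
      obtain E F where EF: "(E, F) \<in> set EFs" and F': "F' = subst \<theta> F"
        and E': "E \<in> Atom ` Z \<or> E' = subst \<theta> E"
        using EFs2_cases[OF *] by blast
      have imp: "nd H (E \<^bold>\<rightarrow> F)" using H(2) EF by (auto simp: B nd_Conjs_iff)
      show ?thesis
      proof (cases "E \<in> Atom ` Z")
        case True
        \<comment> \<open>The conclusion \<open>F\<close> already holds because \<open>z\<close>
          does, so it does not matter what becomes of the premise.\<close>
        then have "nd H F" using imp HZ[OF H(1,2)] nd.ImpE by blast
        then show ?thesis using H\<sigma>[OF H] by (simp add: F' nd_Imp_iff nd_insert)
      next
        case False
        then show ?thesis using H\<sigma>[OF H, of "E \<^bold>\<rightarrow> F"] imp E' F' by simp
      qed
    qed
    then show ?thesis by (auto simp: B2_def subst_Conjs nd_Conjs_iff)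
  qed
  \<comment> \<open>The substitution \<open>\<sigma> c\<close> acts on the implication from
    \<open>B2\<close> only. Its image of \<open>B2\<close> follows from \<open>Y\<close> and
    \<open>B\<close>, so \<open>B\<close> can take the place of that premise.\<close>
  have step: "AR par (Y \<^bold>\<and> (B2 \<^bold>\<rightarrow> E)) D"
    if c: "c \<in> {Top, Bot}" and D: "AR par (Y \<^bold>\<and> (B \<^bold>\<rightarrow> subst (\<sigma> c) E)) D" for c E
  proof (rule AR_And_right[OF AR.sub[OF \<sigma>[of c]]])
    let ?H = "{Y \<^bold>\<and> subst (\<sigma> c) (B2 \<^bold>\<rightarrow> E)}"
    have "nd (insert B ?H) (subst (\<sigma> c) B2)"
      by (rule HB2[OF nd_insert[OF nd_AndD1] nd.Assm c]) simp
    moreover have "nd (insert B ?H) (subst (\<sigma> c) B2 \<^bold>\<rightarrow> subst (\<sigma> c) E)"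
      using nd_insert[OF nd_AndD2] by simp
    ultimately have "nd ?H (B \<^bold>\<rightarrow> subst (\<sigma> c) E)" by (blast intro: nd.ImpE nd.ImpI)
    then show "AR par (Y \<^bold>\<and> subst (\<sigma> c) (B2 \<^bold>\<rightarrow> E)) D"
      by (intro AR_And_weaken[OF D]) (simp_all add: nd.Assm)
  qed
  have weaken: "AR par (Y \<^bold>\<and> A') D" if "AR par (X \<^bold>\<and> A) D" "nd {Y \<^bold>\<and> A'} A" for A A'
    using that(1) less.prems(3) that(2) by (rule AR_And_weaken)
  \<comment> \<open>Setting \<open>z\<close> to \<open>Bot\<close> in the first formula, and to
    \<open>Top\<close> in the second, turns both into \<open>B \<rightarrow> Bot\<close> up to
    equivalence, and \<open>Db\<close> closes the branch.\<close>
  have neg: "AR par (Y \<^bold>\<and> (B2 \<^bold>\<rightarrow> Atom z)) D" "AR par (Y \<^bold>\<and> (B2 \<^bold>\<rightarrow> Atom z \<^bold>\<rightarrow> Bot)) D"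
    if "z \<in> Z" for z
  proof -
    have "AR par (Y \<^bold>\<and> (B \<^bold>\<rightarrow> Bot)) D" by (rule weaken[OF Db nd_AndD2])
    then show "AR par (Y \<^bold>\<and> (B2 \<^bold>\<rightarrow> Atom z)) D"
      using that by (intro step[of Bot]) (simp_all add: \<sigma>_def)
    have "nd (insert B {Y \<^bold>\<and> (B \<^bold>\<rightarrow> Top \<^bold>\<rightarrow> Bot)}) Bot"
      by (rule nd.ImpE[OF _ nd_Top], subst nd_Imp_iff[symmetric]) (rule nd_AndD2)
    then have "nd {Y \<^bold>\<and> (B \<^bold>\<rightarrow> Top \<^bold>\<rightarrow> Bot)} (B \<^bold>\<rightarrow> Bot)" by (rule nd.ImpI)
    then have "AR par (Y \<^bold>\<and> (B \<^bold>\<rightarrow> Top \<^bold>\<rightarrow> Bot)) D" by (rule weaken[OF Db])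
    then show "AR par (Y \<^bold>\<and> (B2 \<^bold>\<rightarrow> Atom z \<^bold>\<rightarrow> Bot)) D"
      using that by (intro step[of Top]) (simp_all add: \<sigma>_def)
  qed
  show ?case
  proof (rule AR_V[OF B2_def])
    \<comment> \<open>Applying \<open>\<theta>\<close> to \<open>B \<rightarrow> z0\<close> gives a
      conclusion \<open>z0 \<or> \<not>z0\<close>, and \<open>B2\<close> derives
      \<open>subst \<theta> B\<close>. So V applies with these two formulas as
      \<open>Es\<close>.\<close>
    let ?G = "subst \<theta> B \<^bold>\<rightarrow> subst \<theta> (Atom z0)" and ?H = "set (map (\<lambda>(E, F). E \<^bold>\<rightarrow> F) EFs2)"
    have H: "nd ?H (E' \<^bold>\<rightarrow> F')" if "(E', F') \<in> set (g (E, F))" "(E, F) \<in> set EFs" for E' F' E F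
    proof (rule nd.Assm)
      have "(E', F') \<in> set EFs2" using that unfolding EFs2_def set_concat set_map by blast
      then show "E' \<^bold>\<rightarrow> F' \<in> ?H" by (force simp: image_iff)
    qed
    have "nd ?H (subst \<theta> E \<^bold>\<rightarrow> subst \<theta> F)" if EF: "(E, F) \<in> set EFs" for E F
    proof (cases "E \<in> Atom ` Z")
      case True
      then have "nd ?H (E \<^bold>\<rightarrow> subst \<theta> F)" "nd ?H ((E \<^bold>\<rightarrow> Bot) \<^bold>\<rightarrow> subst \<theta> F)"
        by - (rule H[OF _ EF], simp add: g_def)+
      then have "nd (insert E (insert (E \<^bold>\<or> (E \<^bold>\<rightarrow> Bot)) ?H)) (subst \<theta> F)"
        "nd (insert (E \<^bold>\<rightarrow> Bot) (insert (E \<^bold>\<or> (E \<^bold>\<rightarrow> Bot)) ?H)) (subst \<theta> F)"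
        by - (rule nd_Imp_iff[THEN iffD1, OF nd_insert], assumption)+
      then have "nd (insert (E \<^bold>\<or> (E \<^bold>\<rightarrow> Bot)) ?H) (subst \<theta> F)"
        by (rule nd.OrE[OF nd.Assm[OF insertI1]])
      moreover have "subst \<theta> E = E \<^bold>\<or> (E \<^bold>\<rightarrow> Bot)" using True by (auto simp: \<theta>_def)
      ultimately show ?thesis by (simp only: nd_Imp_iff)
    next
      case False
      then show ?thesis by (intro H[OF _ EF]) (simp add: g_def)
    qed
    then have "nd ?H (subst \<theta> B)" by (auto simp: B subst_Conjs nd_Conjs_iff)
    then have "nd (?H \<union> {?G}) (subst \<theta> B)" by (auto elim: nd_mono)
    then have "nd (?H \<union> {?G}) (subst \<theta> (Atom z0))"
      by (rule nd.ImpE[rotated]) (simp add: nd.Assm)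
    then have "nd {?G} (B2 \<^bold>\<rightarrow> Disjs [Atom z0, Atom z0 \<^bold>\<rightarrow> Bot])"
      using less.prems(1) unfolding B2_def nd_Conjs_Imp_iff by (simp add: \<theta>_def)
    moreover have "AR par Y (B \<^bold>\<rightarrow> Atom z0)" by (rule AR_nd[OF less.prems(4)[OF less.prems(1)]])
    then have "AR par Y ?G" using AR.Cut AR.sub[OF \<theta>, of "B \<^bold>\<rightarrow> Atom z0"] by auto
    ultimately show "AR par Y (B2 \<^bold>\<rightarrow> Disjs [Atom z0, Atom z0 \<^bold>\<rightarrow> Bot])"
      by (blast intro: AR.Cut AR_nd)
    fix E' assume E': "E' \<in> set (map fst EFs2 @ [Atom z0, Atom z0 \<^bold>\<rightarrow> Bot])"
    then consider (Z) z where "z \<in> Z" "E' = Atom z \<or> E' = Atom z \<^bold>\<rightarrow> Bot"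
      | (other) E where "E \<in> fst ` set EFs" "E \<notin> Atom ` Z" "E' = subst \<theta> E"
    proof (cases "E' \<in> set (map fst EFs2)")
      case True
      then obtain F' where "(E', F') \<in> set EFs2" by auto
      from EFs2_cases[OF this] show ?thesis using Z other by force
    next
      case False
      then show ?thesis using E' less.prems(1) Z by auto
    qed
    then show "AR par (Y \<^bold>\<and> bracket par B2 E') D"
    proof cases
      case Z
      then have "bracket par B2 E' = B2 \<^bold>\<rightarrow> E'" using less.prems(2) by (auto simp: bracket_def)
      then show ?thesis using Z neg by auto
    next
      case other
      consider (p) p where "E = Atom p" "p \<in> par" | (x) x where "E = Atom x" "x \<notin> par" "x \<notin> Z"
        | (Bot) "E = Bot" | (n) "E \<notin> range Atom" "E \<noteq> Bot"
        using other(2) by blast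
      then show ?thesis
      proof cases
        case p
        then have "bracket par B2 E' = Atom p" using other by (auto simp: bracket_def \<theta>_def)
        then show ?thesis using weaken[OF Dp nd_AndD2] p other(1) by simp
      next
        case x
        then have br: "bracket par B2 E' = B2 \<^bold>\<rightarrow> Atom x" "\<sigma> Top x = Atom x"
          using other by (auto simp: bracket_def \<theta>_def \<sigma>_def)
        have "AR par (Y \<^bold>\<and> (B \<^bold>\<rightarrow> Atom x)) D"
        \<comment> \<open>The variable \<open>x\<close> is not yet in \<open>Z\<close> but follows
          from \<open>B\<close> in this branch, so it joins \<open>Z\<close>.\<close>
        proof (rule less.hyps[of "insert x Z"])
          show "card (- insert x Z) < card (- Z)"
            using x by (intro psubset_card_mono) auto
          show "nd {Y \<^bold>\<and> (B \<^bold>\<rightarrow> Atom x)} X" by (rule nd_trans[OF nd_AndD1 less.prems(3)])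
          show "nd {Y \<^bold>\<and> (B \<^bold>\<rightarrow> Atom x)} (B \<^bold>\<rightarrow> Atom z)" if "z \<in> insert x Z" for z
          proof (cases "z = x")
            case True
            then show ?thesis by (simp add: nd_AndD2)
          next
            case False
            with that have "z \<in> Z" by simp
            then show ?thesis by (intro nd_trans[OF nd_AndD1 less.prems(4)])
          qed
        qed (use less.prems(1,2) x in auto)
        then show ?thesis unfolding br(1) by (intro step[of Top]) (simp_all add: br(2))
      next
        case Bot
        then show ?thesis using other(3) by (simp add: bracket_def AR_And_Bot)
      next
        case n
        then have br: "bracket par B2 E' = B2 \<^bold>\<rightarrow> subst \<theta> E"
          using other(3) by (cases E) (auto simp: bracket_def)
        let ?H = "{Y \<^bold>\<and> (B \<^bold>\<rightarrow> subst (\<sigma> Top) (subst \<theta> E))}"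
        have "nd (insert B ?H) (subst (\<sigma> Top) (subst \<theta> E))"
          by (rule nd_Imp_iff[THEN iffD1]) (rule nd_AndD2)
        moreover have "nd (insert B ?H) Y" by (rule nd_insert[OF nd_AndD1])
        moreover have "nd (insert B ?H) B" by (simp add: nd.Assm)
        ultimately have "nd (insert B ?H) E" using H\<sigma> by simp
        then have "nd ?H (B \<^bold>\<rightarrow> E)" by (rule nd.ImpI)
        then have "AR par (Y \<^bold>\<and> (B \<^bold>\<rightarrow> subst (\<sigma> Top) (subst \<theta> E))) D"
          by (rule weaken[OF Dn[OF other(1) n]])
        then show ?thesis unfolding br by (intro step[of Top]) simp_all
      qed
    qed
  qed
qed

text \<open>The sharpened V: nothing is asked of branches for variables or \<open>Bot\<close>.
  \<open>AR_Imp_variable\<close>, started with a single variable in \<open>Z\<close>, closes the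
  former; the latter are contradictory.\<close>

lemma AR_V_variable:
  fixes par :: "'a::finite set"
  assumes B: "B = Conjs (map (\<lambda>(E, F). E \<^bold>\<rightarrow> F) EFs)"
    and X: "nd {X} (B \<^bold>\<rightarrow> Disjs Es)"
    and Dn: "\<And>E. E \<in> set (map fst EFs @ Es) \<Longrightarrow> E \<notin> range Atom \<Longrightarrow> E \<noteq> Bot \<Longrightarrow>
      AR par (X \<^bold>\<and> (B \<^bold>\<rightarrow> E)) D"
    and Dp: "\<And>p. Atom p \<in> set (map fst EFs @ Es) \<Longrightarrow> p \<in> par \<Longrightarrow> AR par (X \<^bold>\<and> Atom p) D"
  shows "AR par X D"
proof -
  let ?Y = "X \<^bold>\<and> (B \<^bold>\<rightarrow> Bot)"
  have Db: "AR par ?Y D"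
  proof (cases "\<exists>E\<in>fst ` set EFs. E \<notin> range Atom \<and> E \<noteq> Bot")
    case True
    then obtain E where E: "E \<in> fst ` set EFs" "E \<notin> range Atom" "E \<noteq> Bot" by blast
    have "nd (insert B {?Y}) Bot"
      by (rule nd_Imp_iff[THEN iffD1]) (rule nd_AndD2)
    then have "nd {?Y} (B \<^bold>\<rightarrow> E)" by (rule nd.ImpI[OF nd.BotE])
    moreover have "AR par (X \<^bold>\<and> (B \<^bold>\<rightarrow> E)) D" using Dn E by simp
    ultimately show ?thesis by (rule AR_nd_trans[OF nd.AndI[OF nd_AndD1]])
  next
    case False
    \<comment> \<open>Here all premises in \<open>B\<close> are atoms or \<open>Bot\<close>. Sending
      every variable to \<open>Bot\<close> leaves only parameters and \<open>Bot\<close> as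
      premises, and V with an empty \<open>Es\<close> has no further branches.\<close>
    define \<theta> where "\<theta> = (\<lambda>a. if a \<in> par then Atom a else Bot)"
    have \<theta>: "substitution par \<theta>" by (simp add: substitution_def \<theta>_def)
    show ?thesis
    proof (rule AR_V)
      show "subst \<theta> B = Conjs (map (\<lambda>(E, F). E \<^bold>\<rightarrow> F) (map (map_prod (subst \<theta>) (subst \<theta>)) EFs))"
        by (simp add: B subst_Conjs comp_def case_prod_unfold)
      show "AR par ?Y (subst \<theta> B \<^bold>\<rightarrow> Disjs [])"
        using AR_nd_trans[OF nd_AndD2 AR.sub[OF \<theta>, of "B \<^bold>\<rightarrow> Bot"]] by simp
      fix E' assume "E' \<in> set (map fst (map (map_prod (subst \<theta>) (subst \<theta>)) EFs) @ [])"
      then obtain E where E: "E \<in> fst ` set EFs" "E' = subst \<theta> E" by force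
      with False consider (p) p where "E = Atom p" "p \<in> par" | "E' = Bot"
        by (force simp: \<theta>_def)
      then show "AR par (?Y \<^bold>\<and> bracket par (subst \<theta> B) E') D"
      proof cases
        case p
        then have "bracket par (subst \<theta> B) E' = Atom p" using E by (simp add: bracket_def \<theta>_def)
        moreover have "AR par (X \<^bold>\<and> Atom p) D" using Dp p E by auto
        ultimately show ?thesis using AR_And_weaken[OF _ nd_AndD1 nd_AndD2] by simp
      qed (simp add: bracket_def AR_And_Bot)
    qed
  qed
  show ?thesis
  proof (rule AR_V[OF B AR_nd[OF X]])
    fix E assume E: "E \<in> set (map fst EFs @ Es)"
    consider (p) p where "E = Atom p" "p \<in> par" | (x) x where "E = Atom x" "x \<notin> par"
      | (Bot) "E = Bot" | (n) "E \<notin> range Atom" "E \<noteq> Bot"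
      by blast
    then show "AR par (X \<^bold>\<and> bracket par B E) D"
    proof cases
      case p
      then show ?thesis using Dp E by (simp add: bracket_def)
    next
      case x
      have "AR par (X \<^bold>\<and> (B \<^bold>\<rightarrow> Atom x)) D"
        by (rule AR_Imp_variable[OF B Dn Dp Db, of x "{x}"])
          (use x(2) in \<open>auto simp: nd_AndD1 nd_AndD2\<close>)
      moreover have "bracket par B E = B \<^bold>\<rightarrow> Atom x" using x by (auto simp: bracket_def)
      ultimately show ?thesis by simp
    next
      case Bot
      then show ?thesis by (simp add: bracket_def AR_And_Bot)
    next
      case n
      then have "bracket par B E = B \<^bold>\<rightarrow> E" by (auto simp: bracket_def)
      then show ?thesis using Dn[OF E n] by simp
    qed
  qed
qed

section \<open>Existence of the NNIL approximation\<close>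

lemma nd_And_insert: "nd (insert (A \<^bold>\<and> B) H) A" "nd (insert (A \<^bold>\<and> B) H) B"
  using nd.Assm[of "A \<^bold>\<and> B" "insert (A \<^bold>\<and> B) H"] by (simp_all add: nd_And_iff)

text \<open>Reduction step of the search: it may pass to a formula that is preserved from
  \<open>X\<close> without being implied by it, as long as it implies \<open>X\<close>.\<close>

lemma is_star_equiv:
  assumes "AR par X Y" "nd {Y} X" "atoms Y \<subseteq> atoms X" "is_star par Y S"
  shows "is_star par X S"
  using assms unfolding is_star_def IPC_Imp_iff by (blast intro: AR.Cut nd_trans)

lemma is_star_And: "is_star par X S \<Longrightarrow> is_star par Y T \<Longrightarrow> is_star par (X \<^bold>\<and> Y) (S \<^bold>\<and> T)"
  unfolding is_star_def IPC_Imp_iff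
  by (auto intro: NNIL_over_And intro!: nd.AndI AR.Conj
      elim: nd_trans[OF nd_AndD1] nd_trans[OF nd_AndD2] AR_nd_trans[OF nd_AndD1] AR_nd_trans[OF nd_AndD2])

text \<open>This is where \<open>Mont\<close> enters: a parameter is a positive formula, so it may
  remain as a premise in the NNIL formula.\<close>

lemma is_star_param:
  assumes "p \<in> par" "is_star par X S"
  shows "is_star par (Atom p \<^bold>\<rightarrow> X) (Atom p \<^bold>\<rightarrow> S)"
proof -
  let ?H = "insert (Atom p) {Atom p \<^bold>\<rightarrow> S}"
  have "nd ?H S" by (rule nd.ImpE[of _ "Atom p"]) (simp_all add: nd.Assm)
  then have "nd ?H X" using assms(2) unfolding is_star_def IPC_Imp_iff by (blast intro: nd_trans)
  then show ?thesis
    using assms by (auto simp: is_star_def IPC_Imp_iff NNIL_over_Imp AR.Mont intro: nd.ImpI)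
qed

text \<open>Weights as in Dyckhoff's contraction-free calculus, with every variable as heavy as \<open>Top\<close>,
  so that substituting \<open>Top\<close> for a variable does not change the weight.\<close>

primrec weight :: "'a set \<Rightarrow> 'a fm \<Rightarrow> nat" where
  "weight par (Atom a) = (if a \<in> par then 1 else 3)"
| "weight par Bot = 1"
| "weight par (A \<^bold>\<and> B) = weight par A + weight par B + 2"
| "weight par (A \<^bold>\<or> B) = weight par A + weight par B + 1"
| "weight par (A \<^bold>\<rightarrow> B) = weight par A + weight par B + 1"

lemma weight_pos: "0 < weight par A"
  by (induction A) auto

lemma weight_subst:
  "(\<And>a. weight par (\<theta> a) = weight par (Atom a)) \<Longrightarrow> weight par (subst \<theta> A) = weight par A"
  by (induction A) auto

text \<open>The multiset order on weights, coded by a number: at most three formulas of smaller weight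
  ever replace one.\<close>

definition cost :: "'a set \<Rightarrow> 'a fm \<Rightarrow> nat" where
  "cost par A = 4 ^ weight par A"

lemma cost_less: "weight par A < weight par B \<Longrightarrow> 3 * cost par A < cost par B"
  using power_increasing[of "Suc (weight par A)" "weight par B" "4::nat"]
    zero_less_power[of "4::nat" "weight par A"]
  unfolding cost_def power_Suc by linarith

lemma cost_pos: "0 < cost par A"
  by (simp add: cost_def)

definition rank :: "'a set \<Rightarrow> 'a fm list \<Rightarrow> 'a fm \<Rightarrow> nat" where
  "rank par \<Gamma> C = (\<Sum>A\<leftarrow>\<Gamma>. cost par A) + cost par C"

text \<open>Antecedents are lists, so that \<open>rank\<close> counts repetitions, but only their
  sets matter for derivability. Further copies of \<open>A\<close> may remain in \<Gamma>' without
  harm.\<close>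

lemma list_extract:
  assumes "A \<in> set \<Gamma>"
  obtains \<Gamma>' where "set \<Gamma> = insert A (set \<Gamma>')"
    "(\<Sum>A\<leftarrow>\<Gamma>. cost par A) = cost par A + (\<Sum>A\<leftarrow>\<Gamma>'. cost par A)"
proof
  show "set \<Gamma> = insert A (set (remove1 A \<Gamma>))"
    using assms by (induction \<Gamma>) auto
  show "(\<Sum>A\<leftarrow>\<Gamma>. cost par A) =
        cost par A + (\<Sum>A\<leftarrow>remove1 A \<Gamma>. cost par A)"
    using assms by (rule sum_list_map_remove1)
qed

section \<open>Sequents written as implications\<close>

lemma nd_sequent:
  assumes "\<And>A. A \<in> set \<Gamma> \<Longrightarrow> nd (set \<Delta>) A" "nd (insert C (set \<Delta>)) D"
  shows "nd {Conjs \<Gamma> \<^bold>\<rightarrow> C} (Conjs \<Delta> \<^bold>\<rightarrow> D)"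
proof -
  let ?H = "set \<Delta> \<union> {Conjs \<Gamma> \<^bold>\<rightarrow> C}"
  have "nd ?H (Conjs \<Gamma>)" using assms(1) by (auto simp: nd_Conjs_iff intro: nd_insert)
  then have "nd ?H C" by (rule nd.ImpE[rotated]) (simp add: nd.Assm)
  moreover have "nd (insert C ?H) D" by (rule nd_mono[OF assms(2)]) auto
  ultimately show ?thesis unfolding nd_Conjs_Imp_iff by (rule nd_cut)
qed

lemma nd_sequentE:
  assumes "nd H (Conjs \<Gamma> \<^bold>\<rightarrow> C)" "\<And>A. A \<in> set \<Gamma> \<Longrightarrow> nd H A"
  shows "nd H C"
  using assms by (metis nd.ImpE nd_Conjs_iff)

lemma atoms_subst_subset: "(\<And>a. atoms (\<theta> a) \<subseteq> {a}) \<Longrightarrow> atoms (subst \<theta> A) \<subseteq> atoms A"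
  by (induction A) auto

text \<open>The sharpened V splits the sequent into branches. Each branch is preserved to an NNIL
  formula that implies the sequent, and the disjunction of these formulas has the required
  properties.\<close>

lemma is_star_irreducible:
  fixes par :: "'a::finite set"
  assumes IH: "\<And>\<Delta> D. rank par \<Delta> D < rank par \<Gamma> C \<Longrightarrow> \<exists>S. is_star par (Conjs \<Delta> \<^bold>\<rightarrow> D) S"
    and \<Gamma>: "\<And>A. A \<in> set \<Gamma> \<Longrightarrow>
      \<exists>E F. A = E \<^bold>\<rightarrow> F \<and> (E \<in> range Atom \<or> E = Bot \<or> (\<exists>G H. E = G \<^bold>\<rightarrow> H))"
    and C: "C \<in> range Atom \<or> C = Bot \<or> (\<exists>G H. C = G \<^bold>\<or> H)"
  shows "\<exists>S. is_star par (Conjs \<Gamma> \<^bold>\<rightarrow> C) S"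
proof -
  define X where "X = Conjs \<Gamma> \<^bold>\<rightarrow> C"
  define EFs where "EFs = map (\<lambda>A. case A of E \<^bold>\<rightarrow> F \<Rightarrow> (E, F)) \<Gamma>"
  define Es where "Es = (case C of G \<^bold>\<or> H \<Rightarrow> [G, H] | _ \<Rightarrow> [C])"
  have Es: "C = Disjs Es" using C by (auto simp: Es_def)
  have EFs: "map (\<lambda>(E, F). E \<^bold>\<rightarrow> F) EFs = \<Gamma>"
    unfolding EFs_def map_map by (rule map_idI) (use \<Gamma> in fastforce)
  have in\<Gamma>: "\<exists>F. E \<^bold>\<rightarrow> F \<in> set \<Gamma>" if "E \<in> set (map fst EFs)" for E
    using that arg_cong[OF EFs, of set] by force
  have \<Gamma>E: "E \<in> range Atom \<or> E = Bot \<or> (\<exists>G H. E = G \<^bold>\<rightarrow> H)" if "E \<^bold>\<rightarrow> F \<in> set \<Gamma>" for E F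
    using \<Gamma>[OF that] by simp
  have XC: "nd (insert S (set \<Gamma>)) C \<Longrightarrow> nd {S} X" for S
    by (simp add: X_def nd_Conjs_Imp_iff)
  \<comment> \<open>\<open>S\<close> serves the branch of \<open>E\<close>: it is an admissible
    disjunct, and the assumption of that branch, if \<open>AR_V_variable\<close> asks for it, is
    preserved to it.\<close>
  define approx where "approx E S \<longleftrightarrow> S \<in> NNIL_over par \<and> atoms S \<subseteq> atoms X \<and> nd {S} X \<and>
    (E \<notin> range Atom \<longrightarrow> E \<noteq> Bot \<longrightarrow> AR par (X \<^bold>\<and> (Conjs \<Gamma> \<^bold>\<rightarrow> E)) S) \<and>
    (\<forall>p\<in>par. E = Atom p \<longrightarrow> AR par (X \<^bold>\<and> Atom p) S)" for E S
  \<comment> \<open>The sharpened V asks nothing of these branches, so \<open>Bot\<close> is a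
    suitable default.\<close>
  have ap_Bot: "approx E Bot" if "E = Bot \<or> (\<exists>x. E = Atom x \<and> x \<notin> par)" for E
    using that nd.BotE[of "{Bot}" X] by (auto simp: approx_def NNIL_over_Bot nd.Assm)
  have ap_left: "\<exists>S. approx E S" if EF: "E \<^bold>\<rightarrow> F \<in> set \<Gamma>" for E F
  proof -
    obtain \<Gamma>' where \<Gamma>': "set \<Gamma> = insert (E \<^bold>\<rightarrow> F) (set \<Gamma>')"
      "(\<Sum>A\<leftarrow>\<Gamma>. cost par A) =
        cost par (E \<^bold>\<rightarrow> F) + (\<Sum>A\<leftarrow>\<Gamma>'. cost par A)"
      by (rule list_extract[OF EF])
    have atm: "atoms E \<union> atoms F \<union> (\<Union>A\<in>set \<Gamma>'. atoms A) \<union> atoms C \<subseteq> atoms X"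
      by (auto simp: X_def atoms_Conjs \<Gamma>'(1))
    \<comment> \<open>Right premise of the left implication rule: replacing
      \<open>E \<rightarrow> F\<close> by the stronger \<open>F\<close> gives a sequent implied by
      \<open>X\<close>.\<close>
    have "\<exists>S. is_star par (Conjs (F # \<Gamma>') \<^bold>\<rightarrow> C) S"
      using cost_less[of par "F" "(E \<^bold>\<rightarrow> F)"]
      by (intro IH) (simp add: \<Gamma>'(2) rank_def)
    then obtain S1 where S1: "is_star par (Conjs (F # \<Gamma>') \<^bold>\<rightarrow> C) S1" by blast
    have S1X: "nd H C" if "nd H S1" "nd H F" "\<And>A. A \<in> set \<Gamma>' \<Longrightarrow> nd H A" for H
    proof (rule nd_sequentE)
      show "nd H (Conjs (F # \<Gamma>') \<^bold>\<rightarrow> C)"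
        using S1 that(1) nd_trans unfolding is_star_def IPC_Imp_iff by blast
    qed (use that in auto)
    have "nd {X} (Conjs (F # \<Gamma>') \<^bold>\<rightarrow> C)"
      unfolding X_def by (rule nd_sequent) (auto simp: \<Gamma>'(1) nd.Assm intro: nd.ImpI)
    then have ARS1: "AR par X S1" using S1 AR_nd_trans unfolding is_star_def by blast
    have S1': "S1 \<in> NNIL_over par" "atoms S1 \<subseteq> atoms X"
      using S1 order.trans[of "atoms S1" "atoms (Conjs (F # \<Gamma>') \<^bold>\<rightarrow> C)" "atoms X"] atm
      by (simp_all add: is_star_def atoms_Conjs)
    consider (p) p where "E = Atom p" "p \<in> par" | (x) x where "E = Atom x" "x \<notin> par"
      | (Bot) "E = Bot" | (Imp) G H where "E = G \<^bold>\<rightarrow> H"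
      using \<Gamma>E[OF EF] by blast
    then show ?thesis
    proof cases
      case p
      let ?H = "insert (Atom p \<^bold>\<and> S1) (set \<Gamma>)"
      have *: "nd ?H (Atom p)" "nd ?H S1" by (rule nd_And_insert)+
      have "nd ?H F" by (rule nd.ImpE[OF nd.Assm *(1)]) (use EF p in simp)
      with *(2) have "nd ?H C" by (rule S1X) (simp add: \<Gamma>'(1) nd.Assm)
      then have "nd {Atom p \<^bold>\<and> S1} X" by (rule XC)
      moreover have "AR par (X \<^bold>\<and> Atom p) (Atom p \<^bold>\<and> S1)"
        by (rule AR.Conj[OF AR_nd[OF nd_AndD2] AR_nd_trans[OF nd_AndD1 ARS1]])
      moreover have "atoms (Atom p \<^bold>\<and> S1) \<subseteq> atoms X" using S1'(2) atm p by auto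
      moreover have "Atom p \<^bold>\<and> S1 \<in> NNIL_over par" by (intro NNIL_over_And NNIL_over_Atom p S1')
      ultimately have "approx E (Atom p \<^bold>\<and> S1)" using p by (simp add: approx_def)
      then show ?thesis by blast
    next
      case Imp
      let ?\<Delta> = "(H \<^bold>\<rightarrow> F) # G # \<Gamma>'"
      \<comment> \<open>Dyckhoff's rule for a nested implication: in proving
        \<open>G \<rightarrow> H\<close>, the formula
        \<open>(G \<rightarrow> H) \<rightarrow> F\<close> can be weakened to
        \<open>H \<rightarrow> F\<close>, because \<open>G\<close> is assumed. Three lighter
        formulas replace it.\<close>
      have "\<exists>S. is_star par (Conjs ?\<Delta> \<^bold>\<rightarrow> H) S"
        using cost_less[of par "(H \<^bold>\<rightarrow> F)" "(E \<^bold>\<rightarrow> F)"]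
          cost_less[of par "G" "(E \<^bold>\<rightarrow> F)"]
          cost_less[of par "H" "(E \<^bold>\<rightarrow> F)"] weight_pos[of par G]
        by (intro IH) (simp add: \<Gamma>'(2) rank_def Imp)
      then obtain S2 where S2: "is_star par (Conjs ?\<Delta> \<^bold>\<rightarrow> H) S2" by blast
      have S2X: "nd K H" if "nd K S2" "nd K G" "nd K (H \<^bold>\<rightarrow> F)" "\<And>A. A \<in> set \<Gamma>' \<Longrightarrow> nd K A" for K
      proof (rule nd_sequentE)
        show "nd K (Conjs ?\<Delta> \<^bold>\<rightarrow> H)"
          using S2 that(1) nd_trans unfolding is_star_def IPC_Imp_iff by blast
      qed (use that in auto)
      have HF: "nd K (H \<^bold>\<rightarrow> F)" if "nd K ((G \<^bold>\<rightarrow> H) \<^bold>\<rightarrow> F)" for K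
      proof (rule nd.ImpI[OF nd.ImpE[OF nd_insert[OF that] nd.ImpI]])
        show "nd (insert G (insert H K)) H" by (simp add: nd.Assm)
      qed
      let ?S = "S1 \<^bold>\<and> S2" and ?K = "insert (S1 \<^bold>\<and> S2) (set \<Gamma>)"
      have S: "nd ?K S1" "nd ?K S2" by (rule nd_And_insert)+
      have EFK: "nd ?K ((G \<^bold>\<rightarrow> H) \<^bold>\<rightarrow> F)" using EF by (simp add: nd.Assm Imp)
      have "nd (insert G ?K) H"
      proof (rule S2X)
        show "nd (insert G ?K) A" if "A \<in> set \<Gamma>'" for A using that by (simp add: \<Gamma>'(1) nd.Assm)
      qed (rule nd_insert[OF S(2)], simp add: nd.Assm, rule nd_insert[OF HF[OF EFK]])
      then have "nd ?K (G \<^bold>\<rightarrow> H)" by (rule nd.ImpI)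
      with EFK have "nd ?K F" by (rule nd.ImpE)
      with S(1) have "nd ?K C" by (rule S1X) (simp add: \<Gamma>'(1) nd.Assm)
      then have SX: "nd {?S} X" by (rule XC)
      have "nd {Conjs \<Gamma> \<^bold>\<rightarrow> E} (Conjs ?\<Delta> \<^bold>\<rightarrow> H)"
      proof (rule nd_sequent)
        show "nd (insert E (set ?\<Delta>)) H"
          by (rule nd.ImpE[of _ G]) (simp_all add: nd.Assm Imp)
        fix A assume "A \<in> set \<Gamma>"
        moreover have "nd (set ?\<Delta>) (E \<^bold>\<rightarrow> F)"
        proof (rule nd.ImpI)
          have "nd (insert E (set ?\<Delta>)) H"
            by (rule nd.ImpE[of _ G]) (simp_all add: nd.Assm Imp)
          then show "nd (insert E (set ?\<Delta>)) F" by (rule nd.ImpE[rotated]) (simp add: nd.Assm)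
        qed
        ultimately show "nd (set ?\<Delta>) A" by (auto simp: \<Gamma>'(1) nd.Assm)
      qed
      then have "AR par (Conjs \<Gamma> \<^bold>\<rightarrow> E) S2"
        using S2 AR_nd_trans unfolding is_star_def by blast
      then have "AR par (X \<^bold>\<and> (Conjs \<Gamma> \<^bold>\<rightarrow> E)) ?S"
        by (intro AR.Conj AR_nd_trans[OF nd_AndD1 ARS1] AR_nd_trans[OF nd_AndD2])
      moreover have "?S \<in> NNIL_over par" "atoms ?S \<subseteq> atoms X"
        using S1' S2 atm order.trans[of "atoms S2" "atoms (Conjs ?\<Delta> \<^bold>\<rightarrow> H)" "atoms X"]
        by (simp_all add: is_star_def atoms_Conjs Imp NNIL_over_And)
      ultimately have "approx E ?S" using SX Imp by (simp add: approx_def)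
      then show ?thesis by blast
    qed (use ap_Bot in auto)
  qed
  have ap_right: "\<exists>S. approx E S" if E: "E \<in> set Es" for E
  proof -
    have atm: "atoms E \<subseteq> atoms X" using E by (auto simp: X_def Es atoms_Disjs)
    have XE: "nd {S} X" if "nd (insert S (set \<Gamma>)) E" for S
      by (rule XC) (unfold Es, rule nd_Disjs[OF E that])
    consider (p) p where "E = Atom p" "p \<in> par" | (x) x where "E = Atom x" "x \<notin> par"
      | (Bot) "E = Bot" | (n) "E \<notin> range Atom" "E \<noteq> Bot" by blast
    then show ?thesis
    proof cases
      case p
      have "nd {E} X" by (rule XE) (simp add: nd.Assm)
      then have "approx E E" using p atm by (simp add: approx_def NNIL_over_Atom AR_nd nd_AndD2)
      then show ?thesis by blast
    next
      case n
      \<comment> \<open>\<open>C\<close> must be a disjunction here: otherwise \<open>Es\<close>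
        would hold just an atom or \<open>Bot\<close>.\<close>
      then have "weight par E < weight par C" using C E by (auto simp: Es_def)
      then have "\<exists>S. is_star par (Conjs \<Gamma> \<^bold>\<rightarrow> E) S"
        using cost_less[of par E C] by (intro IH) (simp add: rank_def)
      then obtain S where S: "is_star par (Conjs \<Gamma> \<^bold>\<rightarrow> E) S" by blast
      have "nd (insert S (set \<Gamma>)) E"
        using S by (simp add: is_star_def IPC_Imp_iff nd_Conjs_Imp_iff)
      then have "nd {S} X" by (rule XE)
      moreover have "AR par (X \<^bold>\<and> (Conjs \<Gamma> \<^bold>\<rightarrow> E)) S"
        by (rule AR_nd_trans[OF nd_AndD2]) (use S in \<open>simp add: is_star_def\<close>)
      moreover have "atoms S \<subseteq> atoms X"
        using S atm unfolding is_star_def X_def by auto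
      ultimately have "approx E S" using S n by (simp add: approx_def is_star_def image_iff)
      then show ?thesis by blast
    qed (use ap_Bot in auto)
  qed
  have "\<exists>S. approx E S" if "E \<in> set (map fst EFs @ Es)" for E
    using that ap_left in\<Gamma> ap_right by (metis Un_iff set_append)
  then obtain f where f: "\<And>E. E \<in> set (map fst EFs @ Es) \<Longrightarrow> approx E (f E)" by metis
  define Ss where "Ss = map f (map fst EFs @ Es)"
  have Ss: "\<exists>E\<in>set (map fst EFs @ Es). S = f E" if "S \<in> set Ss" for S
    using that by (auto simp: Ss_def)
  have to_D: "AR par A (Disjs Ss)" if "AR par A (f E)" "E \<in> set (map fst EFs @ Es)" for A E
    using that(1) by (rule AR.Cut)
      (rule AR_nd, rule nd_Disjs[of "f E"], use that(2) in \<open>auto simp: Ss_def nd.Assm\<close>)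
  have "is_star par X (Disjs Ss)"
    unfolding is_star_def
  proof (intro conjI)
    show "Disjs Ss \<in> NNIL_over par"
      by (rule NNIL_over_Disjs) (use Ss f in \<open>auto simp: approx_def\<close>)
    show "atoms (Disjs Ss) \<subseteq> atoms X"
      unfolding atoms_Disjs using Ss f approx_def by blast
    show "IPC (Disjs Ss \<^bold>\<rightarrow> X)" unfolding IPC_Imp_iff
    proof (rule nd_DisjsE[OF nd.Assm])
      fix S assume "S \<in> set Ss"
      then have "nd {S} X" using Ss f approx_def by blast
      then show "nd {S, Disjs Ss} X" by (rule nd_mono) blast
    qed simp
    show "AR par X (Disjs Ss)"
    proof (rule AR_V_variable[of "Conjs \<Gamma>" EFs X Es])
      show "Conjs \<Gamma> = Conjs (map (\<lambda>(E, F). E \<^bold>\<rightarrow> F) EFs)" by (simp only: EFs)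
      show "nd {X} (Conjs \<Gamma> \<^bold>\<rightarrow> Disjs Es)" by (simp add: X_def Es nd.Assm)
    qed (use f approx_def to_D in blast)+
  qed
  then show ?thesis unfolding X_def by blast
qed

text \<open>Proof search by induction on \<open>rank\<close>. Invertible rules replace the sequent
  by equivalent lighter ones, a parameter in the antecedent is pulled out as a premise, and a
  variable there is substituted away. Only irreducible sequents need V.\<close>

lemma is_star_sequent:
  fixes par :: "'a::finite set"
  shows "\<exists>S. is_star par (Conjs \<Gamma> \<^bold>\<rightarrow> C) S"
proof (induction "rank par \<Gamma> C" arbitrary: \<Gamma> C rule: less_induct)
  case less
  let ?X = "Conjs \<Gamma> \<^bold>\<rightarrow> C"
  have IH: "\<exists>S. is_star par (Conjs \<Delta> \<^bold>\<rightarrow> D) S" if "rank par \<Delta> D < rank par \<Gamma> C" for \<Delta> D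
    using less that by blast
  have equiv: "\<exists>S. is_star par ?X S"
    if "\<exists>S. is_star par Y S" "nd {?X} Y" "nd (insert Y (set \<Gamma>)) C" "atoms Y \<subseteq> atoms ?X" for Y
  proof -
    have "nd {Y} ?X" using that(3) by (simp add: nd_Conjs_Imp_iff)
    then show ?thesis using that is_star_equiv[OF AR_nd] by blast
  qed
  have replace: "\<exists>S. is_star par ?X S"
    if "rank par \<Delta> D < rank par \<Gamma> C" "\<And>A. A \<in> set \<Gamma> \<Longrightarrow> nd (set \<Delta>) A" "nd (insert C (set \<Delta>)) D"
      "\<And>A. A \<in> set \<Delta> \<Longrightarrow> nd (set \<Gamma>) A" "nd (insert D (set \<Gamma>)) C"
      "atoms (Conjs \<Delta> \<^bold>\<rightarrow> D) \<subseteq> atoms ?X" for \<Delta> D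
  proof (rule equiv[OF IH[OF that(1)] nd_sequent[OF that(2,3)] _ that(6)])
    have "nd (insert (Conjs \<Delta> \<^bold>\<rightarrow> D) (set \<Gamma>)) D"
      by (rule nd_sequentE[OF nd.Assm]) (auto intro: nd_insert that(4))
    moreover have "nd (insert D (insert (Conjs \<Delta> \<^bold>\<rightarrow> D) (set \<Gamma>))) C"
      by (rule nd_mono[OF that(5)]) auto
    ultimately show "nd (insert (Conjs \<Delta> \<^bold>\<rightarrow> D) (set \<Gamma>)) C" by (rule nd_cut)
  qed
  have Conj: "\<exists>S. is_star par (Y1 \<^bold>\<and> Y2) S"
    if "\<exists>S. is_star par Y1 S" "\<exists>S. is_star par Y2 S" for Y1 Y2
    using that is_star_And by blast
  note atoms_Conjs[simp]
  consider (And) A B where "A \<^bold>\<and> B \<in> set \<Gamma>" | (Or) A B where "A \<^bold>\<or> B \<in> set \<Gamma>" | (Bot) "Bot \<in> set \<Gamma>"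
    | (par) p where "Atom p \<in> set \<Gamma>" "p \<in> par" | (var) x where "Atom x \<in> set \<Gamma>" "x \<notin> par"
    | (AndImp) G H F where "G \<^bold>\<and> H \<^bold>\<rightarrow> F \<in> set \<Gamma>" | (OrImp) G H F where "G \<^bold>\<or> H \<^bold>\<rightarrow> F \<in> set \<Gamma>"
    | (AndR) A B where "C = A \<^bold>\<and> B" | (ImpR) A B where "C = A \<^bold>\<rightarrow> B"
    | (irr) "\<And>A. A \<in> set \<Gamma> \<Longrightarrow>
        \<exists>E F. A = E \<^bold>\<rightarrow> F \<and> (E \<in> range Atom \<or> E = Bot \<or> (\<exists>G H. E = G \<^bold>\<rightarrow> H))"
      "C \<in> range Atom \<or> C = Bot \<or> (\<exists>G H. C = G \<^bold>\<or> H)"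
    by (metis fm.exhaust rangeI)
  then show ?case
  proof cases
    case And
    obtain \<Gamma>' where \<Gamma>': "set \<Gamma> = insert (A \<^bold>\<and> B) (set \<Gamma>')"
      "(\<Sum>A\<leftarrow>\<Gamma>. cost par A) =
        cost par (A \<^bold>\<and> B) + (\<Sum>A\<leftarrow>\<Gamma>'. cost par A)"
      by (rule list_extract[OF And])
    show ?thesis
    proof (rule replace[of "A # B # \<Gamma>'" C])
      show "rank par (A # B # \<Gamma>') C < rank par \<Gamma> C"
        using cost_less[of par "A" "(A \<^bold>\<and> B)"]
          cost_less[of par "B" "(A \<^bold>\<and> B)"] by (simp add: rank_def \<Gamma>'(2))
      have "nd (set \<Gamma>) (A \<^bold>\<and> B)" by (simp add: nd.Assm And)
      then show "nd (set \<Gamma>) D" if "D \<in> set (A # B # \<Gamma>')" for D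
        using that by (auto simp: \<Gamma>'(1) nd_And_iff nd.Assm)
    qed (auto simp: \<Gamma>'(1) nd_And_iff nd.Assm)
  next
    case Or
    obtain \<Gamma>' where \<Gamma>': "set \<Gamma> = insert (A \<^bold>\<or> B) (set \<Gamma>')"
      "(\<Sum>A\<leftarrow>\<Gamma>. cost par A) =
        cost par (A \<^bold>\<or> B) + (\<Sum>A\<leftarrow>\<Gamma>'. cost par A)"
      by (rule list_extract[OF Or])
    let ?Y1 = "Conjs (A # \<Gamma>') \<^bold>\<rightarrow> C" and ?Y2 = "Conjs (B # \<Gamma>') \<^bold>\<rightarrow> C"
    show ?thesis
    proof (rule equiv[of "?Y1 \<^bold>\<and> ?Y2"])
      show "\<exists>S. is_star par (?Y1 \<^bold>\<and> ?Y2) S"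
        using cost_less[of par "A" "(A \<^bold>\<or> B)"]
          cost_less[of par "B" "(A \<^bold>\<or> B)"]
        by (intro Conj IH) (simp_all add: rank_def \<Gamma>'(2))
      show "nd {?X} (?Y1 \<^bold>\<and> ?Y2)"
        by (intro nd.AndI nd_sequent) (auto simp: \<Gamma>'(1) nd.Assm intro: nd.OrI1 nd.OrI2)
      let ?H = "insert (?Y1 \<^bold>\<and> ?Y2) (set \<Gamma>)"
      have Y: "nd ?H ?Y1" "nd ?H ?Y2" by (rule nd_And_insert)+
      show "nd ?H C"
      proof (rule nd.OrE)
        show "nd ?H (A \<^bold>\<or> B)" by (simp add: nd.Assm Or)
        show "nd (insert A ?H) C"
          by (rule nd_sequentE[OF nd_insert[OF Y(1)]]) (auto simp: \<Gamma>'(1) nd.Assm)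
        show "nd (insert B ?H) C"
          by (rule nd_sequentE[OF nd_insert[OF Y(2)]]) (auto simp: \<Gamma>'(1) nd.Assm)
      qed
    qed (auto simp: \<Gamma>'(1))
  next
    case Bot
    have "nd {Top} ?X" unfolding nd_Conjs_Imp_iff by (rule nd.BotE) (simp add: nd.Assm Bot)
    then have "is_star par ?X Top"
      by (simp add: is_star_def NNIL_over_Top IPC_Imp_iff AR_nd nd_Top)
    then show ?thesis by blast
  next
    case par
    obtain \<Gamma>' where \<Gamma>': "set \<Gamma> = insert (Atom p) (set \<Gamma>')"
      "(\<Sum>A\<leftarrow>\<Gamma>. cost par A) =
        cost par (Atom p) + (\<Sum>A\<leftarrow>\<Gamma>'. cost par A)"
      by (rule list_extract[OF par(1)])
    let ?Y = "Conjs \<Gamma>' \<^bold>\<rightarrow> C"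
    show ?thesis
    proof (rule equiv[of "Atom p \<^bold>\<rightarrow> ?Y"])
      have "\<exists>S. is_star par ?Y S" by (rule IH) (simp add: rank_def \<Gamma>'(2) cost_pos)
      then show "\<exists>S. is_star par (Atom p \<^bold>\<rightarrow> ?Y) S" using is_star_param[OF par(2)] by metis
      show "nd {?X} (Atom p \<^bold>\<rightarrow> ?Y)" unfolding nd_Imp_iff[of _ "Atom p"] nd_Conjs_Imp_iff
        by (rule nd_sequentE[OF nd.Assm]) (auto simp: \<Gamma>'(1) nd.Assm)
      let ?H = "insert (Atom p \<^bold>\<rightarrow> ?Y) (set \<Gamma>)"
      have "nd ?H ?Y" by (rule nd.ImpE[OF nd.Assm nd.Assm]) (auto simp: par)
      then show "nd ?H C" by (rule nd_sequentE) (simp add: \<Gamma>'(1) nd.Assm)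
    qed (auto simp: \<Gamma>'(1))
  next
    case var
    obtain \<Gamma>' where \<Gamma>': "set \<Gamma> = insert (Atom x) (set \<Gamma>')"
      "(\<Sum>A\<leftarrow>\<Gamma>. cost par A) =
        cost par (Atom x) + (\<Sum>A\<leftarrow>\<Gamma>'. cost par A)"
      by (rule list_extract[OF var(1)])
    \<comment> \<open>Preservativity to the image under \<open>\<theta>\<close> is an instance of
      \<open>sub\<close>. Conversely, the image implies the sequent because its antecedent contains
      \<open>x\<close>, which makes \<open>x\<close> equivalent to \<open>Top\<close>.\<close>
    define \<theta> where "\<theta> = Atom(x := Top)"
    have \<theta>: "substitution par \<theta>" using var(2) by (auto simp: substitution_def \<theta>_def)
    have cost: "cost par (subst \<theta> A) = cost par A" for A
      unfolding cost_def by (subst weight_subst) (use var(2) in \<open>simp_all add: \<theta>_def\<close>)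
    let ?Y = "Conjs (map (subst \<theta>) \<Gamma>') \<^bold>\<rightarrow> subst \<theta> C"
    have "\<exists>S. is_star par ?Y S" by (rule IH) (simp add: rank_def \<Gamma>'(2) cost_pos cost comp_def)
    then obtain S where S: "is_star par ?Y S" by blast
    have "is_star par ?X S"
    proof (rule is_star_equiv[OF _ _ _ S])
      have "nd {Conjs (map (subst \<theta>) \<Gamma>) \<^bold>\<rightarrow> subst \<theta> C} ?Y"
        by (rule nd_sequent) (auto simp: \<Gamma>'(1) nd.Assm nd_Top \<theta>_def)
      then show "AR par ?X ?Y"
        using AR.Cut[OF AR.sub[OF \<theta>] AR_nd, of ?X] by (simp add: subst_Conjs)
      let ?H = "set \<Gamma> \<union> {?Y}"
      have H\<theta>: "nd ?H (subst \<theta> A) \<longleftrightarrow> nd ?H A" for A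
        by (rule nd_subst_iff) (auto simp: \<theta>_def var(1) nd.Assm nd_Top)
      have \<Gamma>\<theta>: "nd ?H (subst \<theta> A)" if "A \<in> set \<Gamma>'" for A
        unfolding H\<theta> using that by (simp add: \<Gamma>'(1) nd.Assm)
      have "nd ?H (subst \<theta> C)"
      proof (rule nd_sequentE)
        show "nd ?H ?Y" by (rule nd.Assm) simp
        show "nd ?H A" if A: "A \<in> set (map (subst \<theta>) \<Gamma>')" for A
        proof -
          from A obtain A' where "A' \<in> set \<Gamma>'" "A = subst \<theta> A'" by auto
          then show ?thesis using \<Gamma>\<theta> by (simp only:)
        qed
      qed
      then show "nd {?Y} ?X" by (simp only: H\<theta> nd_Conjs_Imp_iff)
      have "atoms (subst \<theta> A) \<subseteq> atoms A" for A
        by (rule atoms_subst_subset) (simp add: \<theta>_def)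
      then show "atoms ?Y \<subseteq> atoms ?X" by (fastforce simp: \<Gamma>'(1))
    qed
    then show ?thesis by blast
  next
    case AndImp
    obtain \<Gamma>' where \<Gamma>': "set \<Gamma> = insert (G \<^bold>\<and> H \<^bold>\<rightarrow> F) (set \<Gamma>')"
      "(\<Sum>A\<leftarrow>\<Gamma>. cost par A) =
        cost par (G \<^bold>\<and> H \<^bold>\<rightarrow> F) + (\<Sum>A\<leftarrow>\<Gamma>'. cost par A)"
      by (rule list_extract[OF AndImp])
    let ?A = "G \<^bold>\<rightarrow> H \<^bold>\<rightarrow> F"
    show ?thesis
    proof (rule replace[of "?A # \<Gamma>'" C])
      \<comment> \<open>Currying adds one implication; the weight drops because a conjunction counts
        2 and an implication 1.\<close>
      show "rank par (?A # \<Gamma>') C < rank par \<Gamma> C"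
        using cost_less[of par "?A" "(G \<^bold>\<and> H \<^bold>\<rightarrow> F)"]
        by (simp add: rank_def \<Gamma>'(2))
      let ?K = "insert (G \<^bold>\<and> H) (set (?A # \<Gamma>'))"
      have "nd ?K (G \<^bold>\<and> H)" by (simp add: nd.Assm)
      then have K: "nd ?K G" "nd ?K H" by (simp_all only: nd_And_iff)
      have "nd ?K ?A" by (simp add: nd.Assm)
      then have "nd ?K F" by (rule nd.ImpE[OF nd.ImpE[OF _ K(1)] K(2)])
      then have "nd (set (?A # \<Gamma>')) (G \<^bold>\<and> H \<^bold>\<rightarrow> F)" by (rule nd.ImpI)
      then show "nd (set (?A # \<Gamma>')) D" if "D \<in> set \<Gamma>" for D
        using that by (auto simp: \<Gamma>'(1) nd.Assm)
      have "nd (insert H (insert G (set \<Gamma>))) F"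
        by (rule nd.ImpE[of _ "G \<^bold>\<and> H"]) (auto simp: nd_And_iff nd.Assm AndImp)
      then have "nd (set \<Gamma>) ?A" by (intro nd.ImpI)
      then show "nd (set \<Gamma>) D" if "D \<in> set (?A # \<Gamma>')" for D
        using that by (auto simp: \<Gamma>'(1) nd.Assm)
    qed (auto simp: \<Gamma>'(1) nd.Assm)
  next
    case OrImp
    obtain \<Gamma>' where \<Gamma>': "set \<Gamma> = insert (G \<^bold>\<or> H \<^bold>\<rightarrow> F) (set \<Gamma>')"
      "(\<Sum>A\<leftarrow>\<Gamma>. cost par A) =
        cost par (G \<^bold>\<or> H \<^bold>\<rightarrow> F) + (\<Sum>A\<leftarrow>\<Gamma>'. cost par A)"
      by (rule list_extract[OF OrImp])
    let ?\<Delta> = "(G \<^bold>\<rightarrow> F) # (H \<^bold>\<rightarrow> F) # \<Gamma>'"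
    show ?thesis
    proof (rule replace[of ?\<Delta> C])
      show "rank par ?\<Delta> C < rank par \<Gamma> C"
        using cost_less[of par "(G \<^bold>\<rightarrow> F)" "(G \<^bold>\<or> H \<^bold>\<rightarrow> F)"]
          cost_less[of par "(H \<^bold>\<rightarrow> F)" "(G \<^bold>\<or> H \<^bold>\<rightarrow> F)"]
        by (simp add: rank_def \<Gamma>'(2))
      let ?K = "insert (G \<^bold>\<or> H) (set ?\<Delta>)"
      have "nd (insert G ?K) F" "nd (insert H ?K) F"
        by (rule nd.ImpE[of _ G], simp_all add: nd.Assm) (rule nd.ImpE[of _ H], simp_all add: nd.Assm)
      then have "nd ?K F" by (rule nd.OrE[OF nd.Assm[OF insertI1]])
      then have "nd (set ?\<Delta>) (G \<^bold>\<or> H \<^bold>\<rightarrow> F)" by (rule nd.ImpI)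
      then show "nd (set ?\<Delta>) D" if "D \<in> set \<Gamma>" for D
        using that by (auto simp: \<Gamma>'(1) nd.Assm)
      have "nd (insert A (set \<Gamma>)) F" if "A = G \<or> A = H" for A
        by (rule nd.ImpE[of _ "G \<^bold>\<or> H"])
          (use that in \<open>auto simp: nd.Assm OrImp intro: nd.OrI1 nd.OrI2\<close>)
      then have "nd (set \<Gamma>) (G \<^bold>\<rightarrow> F)" "nd (set \<Gamma>) (H \<^bold>\<rightarrow> F)" by (simp_all add: nd_Imp_iff)
      then show "nd (set \<Gamma>) D" if "D \<in> set ?\<Delta>" for D
        using that by (auto simp: \<Gamma>'(1) nd.Assm)
    qed (auto simp: \<Gamma>'(1) nd.Assm)
  next
    case AndR
    let ?Y1 = "Conjs \<Gamma> \<^bold>\<rightarrow> A" and ?Y2 = "Conjs \<Gamma> \<^bold>\<rightarrow> B"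
    show ?thesis
    proof (rule equiv[of "?Y1 \<^bold>\<and> ?Y2"])
      show "\<exists>S. is_star par (?Y1 \<^bold>\<and> ?Y2) S"
        using cost_less[of par A C] cost_less[of par B C]
        by (intro Conj IH) (simp_all add: rank_def AndR)
      have C: "nd (insert C (set \<Gamma>)) C" by (simp add: nd.Assm)
      then show "nd {?X} (?Y1 \<^bold>\<and> ?Y2)"
        unfolding AndR nd_And_iff by (intro conjI nd_sequent) (auto simp: nd.Assm)
      let ?H = "insert (?Y1 \<^bold>\<and> ?Y2) (set \<Gamma>)"
      have Y: "nd ?H ?Y1" "nd ?H ?Y2" by (rule nd_And_insert)+
      have "nd ?H A" by (rule nd_sequentE[OF Y(1)]) (simp add: nd.Assm)
      moreover have "nd ?H B" by (rule nd_sequentE[OF Y(2)]) (simp add: nd.Assm)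
      ultimately show "nd ?H C" unfolding AndR by (rule nd.AndI)
    qed (auto simp: AndR)
  next
    case ImpR
    let ?Y = "Conjs (A # \<Gamma>) \<^bold>\<rightarrow> B"
    show ?thesis
    proof (rule equiv[of ?Y])
      show "\<exists>S. is_star par ?Y S"
        using cost_less[of par "A" "C"] cost_less[of par "B" "C"]
          weight_pos[of par A] by (intro IH) (simp add: rank_def ImpR)
      show "nd {?X} ?Y"
        by (rule nd_sequent, simp add: nd.Assm)
          (rule nd.ImpE[of _ A], simp_all add: nd.Assm ImpR)
      show "nd (insert ?Y (set \<Gamma>)) C"
        unfolding ImpR by (rule nd.ImpI, rule nd_sequentE[OF nd.Assm]) (auto simp: nd.Assm)
    qed (auto simp: ImpR)
  next
    case irr
    with IH show ?thesis by (rule is_star_irreducible)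
  qed
qed

lemma is_star_star:
  fixes par :: "'a::finite set"
  shows "is_star par A (star par A)"
proof -
  \<comment> \<open>With an empty antecedent the sequent is \<open>Top \<rightarrow> A\<close>,
    which is equivalent to \<open>A\<close>.\<close>
  obtain S where S: "is_star par (Conjs [] \<^bold>\<rightarrow> A) S" using is_star_sequent by blast
  have "nd {A} (Conjs [] \<^bold>\<rightarrow> A)" by (simp add: nd_Imp_iff nd.Assm)
  moreover have "nd {Conjs [] \<^bold>\<rightarrow> A} A" by (rule nd_sequentE[of _ "[]"]) (simp_all add: nd.Assm)
  ultimately have "is_star par A S" using S by (intro is_star_equiv[OF AR_nd _ _ S]) simp_all
  then show ?thesis unfolding star_def by (rule someI)
qed

theorem theorem4p22:
  fixes par :: "'a::finite set" and A B :: "'a fm"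
  shows "(AR par A B \<longleftrightarrow> preservativity (NNIL_over par) A B) \<and>
         (preservativity (NNIL_over par) A B \<longleftrightarrow> IPC (star par A \<^bold>\<rightarrow> B))"
proof -
  have star: "star par A \<in> NNIL_over par" "IPC (star par A \<^bold>\<rightarrow> A)" "AR par A (star par A)"
    using is_star_star[of par A] by (simp_all add: is_star_def)
  have "preservativity (NNIL_over par) A B" if "AR par A B"
    using that by (rule AR_preservativity)
  \<comment> \<open>The test formula is \<open>star par A\<close> itself, an NNIL formula that
    implies \<open>A\<close>.\<close>
  moreover have "IPC (star par A \<^bold>\<rightarrow> B)" if "preservativity (NNIL_over par) A B"
    using that star(1,2) by (simp add: preservativity_def)
  moreover have "AR par A B" if "IPC (star par A \<^bold>\<rightarrow> B)"
    using star(3) AR.Ax[OF that] by (rule AR.Cut)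
  ultimately show ?thesis by blast
qed

end
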